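(* Let $\Gamma$ be a (valued) tree with Tits form $\mathcal B$ having matrix ${\bf B}$, and let ${\bf C}$ be its Coxeter transformation, considered over $\mathbb C$. 1) The Jordan form of ${\bf C}$ is diagonal if and only if the Tits form is non-degenerate. 2) If $\mathcal B\ge 0$ (that is, $\Gamma$ is an extended Dynkin diagram), then the Jordan form of ${\bf C}$ contains only one $2\times2$ Jordan block (the other blocks being $1\times 1$), and all eigenvalues of ${\bf C}$ lie on the unit circle. 3) If $\mathcal B$ is indefinite and degenerate, then the number of $2\times2$ Jordan blocks of ${\bf C}$ equals $\dim\ker{\bf B}$ and the remaining Jordan blocks are $1\times1$. There is a simple maximal eigenvalue $\lambda_1^{\varphi_1}$ and a simple minimal eigenvalue $\lambda_2^{\varphi_1}$, and $$\lambda_1^{\varphi_1}>1,\qquad \lambda_2^{\varphi_1}<1.$$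
   Context: $\Gamma$ is a finite connected valued graph without cycles, with generalized Cartan matrix $K$: $k_{ii}=2$, $k_{ij}\in\{0,-1,-2,\dots\}$ for $i\ne j$, $k_{ij}=0\iff k_{ji}=0$. Such $K$ is symmetrizable: $K=T{\bf B}$ with $T$ a positive diagonal matrix and ${\bf B}$ symmetric; ${\bf B}$ is the matrix of the Tits form $\mathcal B$ (for symmetric $K$, $K=2{\bf B}$). In part 2, $\mathcal B\ge0$ means that $\mathcal B$ is nonnegative definite but not positive definite. The vertices are split into classes $S_1,S_2$ so that every edge joins $S_1$ to $S_2$; in the corresponding block form $$K=\begin{pmatrix}2I&2D\\2F&2I\end{pmatrix},\quad w_1=\begin{pmatrix}-I&-2D\\0&I\end{pmatrix},\quad w_2=\begin{pmatrix}I&0\\-2F&-I\end{pmatrix},\quad {\bf C}=w_1w_2$$ ($F=D^t$ in the simply-laced case). All products of all simple reflections, each taken once, are conjugate to ${\bf C}$. $\varphi_1$ denotes the maximal eigenvalue of $DF$ (equivalently of $FD$), which is simple and positive, and $\lambda^{\varphi_1}_{1,2}=2\varphi_1-1\pm2\sqrt{\varphi_1(\varphi_1-1)}$. *)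

theory Defs
  imports
    Complex_Main
    "Jordan_Normal_Form.Jordan_Normal_Form"
    "Jordan_Normal_Form.Matrix_Kernel"
    "Graph_Theory.Graph_Theory"
begin

text \<open>
  A finite valued graph on the vertices \<open>0, ..., n - 1\<close> is given by its generalized Cartan
  matrix \<open>K\<close>; there is an edge between \<open>i \<noteq> j\<close> iff the entry \<open>K $$ (i, j)\<close> is non-zero, and the
  values on this edge are \<open>- K $$ (i, j)\<close> and \<open>- K $$ (j, i)\<close>.
\<close>

definition generalized_cartan_matrix :: "nat \<Rightarrow> int mat \<Rightarrow> bool" where
  "generalized_cartan_matrix n K \<longleftrightarrow>
     K \<in> carrier_mat n n \<and>
     (\<forall>i<n. K $$ (i, i) = 2) \<and>
     (\<forall>i<n. \<forall>j<n. i \<noteq> j \<longrightarrow> K $$ (i, j) \<le> 0 \<and> (K $$ (i, j) = 0 \<longleftrightarrow> K $$ (j, i) = 0))"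

definition valued_graph :: "int mat \<Rightarrow> nat pair_pre_digraph" where
  "valued_graph K =
     \<lparr> pverts = {0..<dim_row K},
       parcs = {(i, j). i < dim_row K \<and> j < dim_row K \<and> i \<noteq> j \<and> K $$ (i, j) \<noteq> 0} \<rparr>"

text \<open>
  An undirected edge is a pair of opposite arcs, and going back and forth along an edge
  is a cycle of length 2 in the sense of \<open>pre_digraph.cycle\<close>.  So the library predicate
  \<open>tree\<close> does not fit, and only cycles of length at least 3 are excluded.
  \<open>Digraph_Component.connected\<close> includes that the vertex set is non-empty.
\<close>

definition valued_tree :: "int mat \<Rightarrow> bool" where
  "valued_tree K \<longleftrightarrow>
     Digraph_Component.connected (with_proj (valued_graph K)) \<and>
     \<not> (\<exists>p. pre_digraph.cycle (with_proj (valued_graph K)) p \<and> 3 \<le> length p)"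

definition symmetrization :: "nat \<Rightarrow> int mat \<Rightarrow> real mat \<Rightarrow> real mat \<Rightarrow> bool" where
  "symmetrization n K T B \<longleftrightarrow>
     T \<in> carrier_mat n n \<and> diagonal_mat T \<and> (\<forall>i<n. 0 < T $$ (i, i)) \<and>
     B \<in> carrier_mat n n \<and> transpose_mat B = B \<and>
     map_mat real_of_int K = T * B"

definition tits_form :: "real mat \<Rightarrow> real vec \<Rightarrow> real" where
  "tits_form B x = x \<bullet> (B *\<^sub>v x)"

definition nondegenerate_form :: "nat \<Rightarrow> real mat \<Rightarrow> bool" where
  "nondegenerate_form n B \<longleftrightarrow>
     (\<forall>x \<in> carrier_vec n. (\<forall>y \<in> carrier_vec n. x \<bullet> (B *\<^sub>v y) = 0) \<longrightarrow> x = 0\<^sub>v n)"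

definition nonnegative_form :: "nat \<Rightarrow> real mat \<Rightarrow> bool" where
  "nonnegative_form n B \<longleftrightarrow> (\<forall>x \<in> carrier_vec n. 0 \<le> tits_form B x)"

definition positive_form :: "nat \<Rightarrow> real mat \<Rightarrow> bool" where
  "positive_form n B \<longleftrightarrow> (\<forall>x \<in> carrier_vec n. x \<noteq> 0\<^sub>v n \<longrightarrow> 0 < tits_form B x)"

definition indefinite_form :: "nat \<Rightarrow> real mat \<Rightarrow> bool" where
  "indefinite_form n B \<longleftrightarrow>
     (\<exists>x \<in> carrier_vec n. 0 < tits_form B x) \<and> (\<exists>x \<in> carrier_vec n. tits_form B x < 0)"

definition w1 :: "real mat \<Rightarrow> real mat" where
  "w1 D = (let m = dim_row D; k = dim_col D in
     four_block_mat (- 1\<^sub>m m) (- (2 \<cdot>\<^sub>m D)) (0\<^sub>m k m) (1\<^sub>m k))"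

definition w2 :: "real mat \<Rightarrow> real mat" where
  "w2 F = (let k = dim_row F; m = dim_col F in
     four_block_mat (1\<^sub>m m) (0\<^sub>m m k) (- (2 \<cdot>\<^sub>m F)) (- 1\<^sub>m k))"

definition coxeter :: "real mat \<Rightarrow> real mat \<Rightarrow> complex mat" where
  "coxeter D F = map_mat complex_of_real (w1 D * w2 F)"

text \<open>
  For a valued tree \<open>D * F\<close> is similar to a symmetric matrix, so its eigenvalues are real and
  the maximum over the real ones is the maximum over all of them.  If the tree has a single vertex,
  one of the two classes is empty and \<open>phi1\<close> is meaningless.
\<close>

definition phi1 :: "real mat \<Rightarrow> real mat \<Rightarrow> real" where
  "phi1 D F = Max {\<phi>. eigenvalue (D * F) \<phi>}"

text \<open>
  The square roots are the intended ones for \<open>\<phi> \<ge> 1\<close> (and \<open>\<phi> = 0\<close>) only; for \<open>0 < \<phi> < 1\<close> the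
  mathematical \<open>\<lambda>\<close> is not real.
\<close>

definition lambda1 :: "real \<Rightarrow> real" where
  "lambda1 \<phi> = 2 * \<phi> - 1 + 2 * sqrt (\<phi> * (\<phi> - 1))"

definition lambda2 :: "real \<Rightarrow> real" where
  "lambda2 \<phi> = 2 * \<phi> - 1 - 2 * sqrt (\<phi> * (\<phi> - 1))"

definition simple_eigenvalue :: "complex mat \<Rightarrow> complex \<Rightarrow> bool" where
  "simple_eigenvalue A x \<longleftrightarrow> eigenvalue A x \<and> Polynomial.order x (char_poly A) = 1"

text \<open>
  The eigenvalues of the Coxeter transformation are complex in general (and \<open>-1\<close> may be one of
  them), so they are compared by absolute value.
\<close>

definition maximal_eigenvalue :: "complex mat \<Rightarrow> complex \<Rightarrow> bool" where
  "maximal_eigenvalue A x \<longleftrightarrow>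
     eigenvalue A x \<and> (\<forall>y. eigenvalue A y \<and> y \<noteq> x \<longrightarrow> cmod y < cmod x)"

definition minimal_eigenvalue :: "complex mat \<Rightarrow> complex \<Rightarrow> bool" where
  "minimal_eigenvalue A x \<longleftrightarrow>
     eigenvalue A x \<and> (\<forall>y. eigenvalue A y \<and> y \<noteq> x \<longrightarrow> cmod x < cmod y)"

text \<open>A Jordan form is a list of pairs (block size, eigenvalue), one for each Jordan block.\<close>

definition num_blocks :: "nat \<Rightarrow> (nat \<times> complex) list \<Rightarrow> nat" where
  "num_blocks s J = length (filter (\<lambda>b. fst b = s) J)"

end

theory Submission
  imports Defs "Jordan_Normal_Form.Jordan_Normal_Form_Uniqueness"
    "HOL-Analysis.Function_Topology"
begin

text \<open>
  Write \<open>K = 2 (1 + N)\<close>, so that \<open>N\<close> has the off-diagonal blocks \<open>D\<close> and \<open>F\<close>, and let \<open>Z\<close> be the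
  diagonal matrix with entries \<open>1\<close> on the first class of vertices and \<open>- 1\<close> on the second.  As every
  edge joins the two classes, \<open>N Z = - Z N\<close>, and the two reflections are
  \<open>w1 = - Z - (1 + Z) N\<close> and \<open>w2 = Z - (1 - Z) N\<close>.  Multiplying out gives the key identity
  \<open>(C + 1)\<^sup>2 = 4 N\<^sup>2 C\<close>, in which \<open>N\<^sup>2\<close> commutes with \<open>C\<close>.

  The symmetrization makes \<open>N\<close> self-adjoint for the inner product with weights \<open>1 / T $$ (i, i)\<close>.
  Hence \<open>N\<^sup>2\<close> is diagonalizable with eigenvalues \<open>\<mu> \<ge> 0\<close>, and on its eigenspace for \<open>\<mu>\<close> the
  transformation \<open>C\<close> satisfies \<open>(C + 1)\<^sup>2 = 4 \<mu> C\<close>.  This quadratic equation has a double root only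
  for \<open>\<mu> = 0\<close>, where \<open>N\<close> vanishes and \<open>C = - 1\<close>, and for \<open>\<mu> = 1\<close>, where the root is \<open>1\<close>.  So the
  blocks of an eigenvalue other than \<open>1\<close> have size \<open>1\<close> (\<open>cox_minus_kernel_square\<close>), and the blocks
  of the eigenvalue \<open>1\<close> have size at most \<open>2\<close> (\<open>cox_minus_one_kernel_cube\<close>).  Moreover \<open>C u = u\<close> holds
  iff \<open>K u = 0\<close>, because \<open>w2 - w1 = Z K\<close>; and then \<open>u = (C - 1) (Z u / 4)\<close>, so that no block
  of the eigenvalue \<open>1\<close> has size \<open>1\<close> (\<open>cox_fixed_in_range\<close>, \<open>jordan_nf_no_unit_block\<close>).  The \<open>2 \<times> 2\<close> blocks
  are therefore exactly the blocks of the eigenvalue \<open>1\<close>, and their number is the dimension of the kernel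
  of the Tits form.

  Now let \<open>s\<close> be the least real number for which \<open>s + N\<close> is positive semidefinite, so that \<open>- s\<close> is
  the least eigenvalue of \<open>N\<close>.  Since \<open>Z\<close> turns \<open>N\<close> into \<open>- N\<close>, all eigenvalues of \<open>N\<^sup>2\<close> lie
  in \<open>[0, s\<^sup>2]\<close>, and \<open>s\<^sup>2\<close> is the largest eigenvalue \<open>\<phi>\<^sub>1\<close> of \<open>D F\<close>.  The entries of \<open>N\<close> are
  nonpositive and the graph is connected, so by the argument of Perron the kernel of \<open>s + N\<close> is a
  line (\<open>perron_line\<close>).  If the Tits form is semidefinite but not definite, then \<open>1 + N\<close> is semidefinite with a kernel:
  there is one \<open>2 \<times> 2\<close> block, and all roots of \<open>(a + 1)\<^sup>2 = 4 \<mu> a\<close> with \<open>0 \<le> \<mu> \<le> 1\<close> have modulus \<open>1\<close>.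
  If it is indefinite, then \<open>s > 1\<close>.  The eigenspace of \<open>N\<^sup>2\<close> for \<open>s\<^sup>2\<close> is spanned by a Perron
  vector \<open>u\<close> and by \<open>Z u\<close>, and \<open>C\<close> acts on it with the two distinct eigenvalues
  \<open>\<lambda>\<^sub>1 > 1 > \<lambda>\<^sub>2 = 1 / \<lambda>\<^sub>1\<close>, which are thus simple.  All other eigenvalues belong to
  some \<open>\<mu> < s\<^sup>2\<close>, and \<open>\<lambda>\<^sub>1\<close> increases with \<open>\<mu>\<close>.
\<close>

section \<open>Kernels and Jordan normal forms\<close>

lemma kernel_dim_cong:
  assumes "A \<in> carrier_mat nr nc" and "B \<in> carrier_mat nr' nc"
    and "mat_kernel A = mat_kernel B"
  shows "kernel_dim A = kernel_dim B"
  using assms by (simp add: kernel_dim_def)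

lemma kernel_dim_pivot_fun:
  assumes A: "A \<in> carrier_mat nr nc" and f: "pivot_fun A f nc"
  shows "kernel_dim A = nc - card {(i, f i) | i. i < nr \<and> f i \<noteq> nc}"
proof -
  have "row_echelon_form A" using A f by (auto simp: row_echelon_form_def)
  then have "kernel_dim A = nc - length (pivot_positions A)"
    using find_base_vectors(5,6)[of A nr nc] A by (simp add: kernel_dim_def)
  also have "length (pivot_positions A) = card (set (pivot_positions A))"
    using pivot_positions(2)[OF A f] by (simp add: distinct_card distinct_map)
  finally show ?thesis by (simp add: pivot_positions(1)[OF A f])
qed

text \<open>
  Gaussian elimination of a real matrix is also one over the complex numbers, and the dimension of
  the kernel can be read off the positions of the pivots.
\<close>

lemma kernel_dim_map_of_real:
  "kernel_dim (map_mat complex_of_real A) = kernel_dim A"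
proof -
  let ?h = "map_mat complex_of_real"
  obtain nr nc where A: "A \<in> carrier_mat nr nc" by blast
  from gauss_jordan_single[OF A refl] obtain P Q where
    E: "gauss_jordan_single A = P * A" and QP: "Q * P = 1\<^sub>m nr"
    and P: "P \<in> carrier_mat nr nr" and Q: "Q \<in> carrier_mat nr nr"
    and PA: "P * A \<in> carrier_mat nr nc" and row: "row_echelon_form (P * A)" by metis
  from row PA obtain f where f: "pivot_fun (P * A) f nc" by (auto simp: row_echelon_form_def)
  have hf: "pivot_fun (?h (P * A)) f nc"
  proof (rule pivot_funI)
    show "dim_row (?h (P * A)) = nr" using PA by auto
  next
    note dR = carrier_matD(1)[OF PA] and dC = carrier_matD(2)[OF PA]
    note piv = pivot_funD[OF dR f]
    fix i assume i: "i < nr"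
    show "f i \<le> nc" using piv(1) i .
    show "Suc i < nr \<Longrightarrow> f (Suc i) > f i \<or> f (Suc i) = nc" using piv(3) i .
    show "?h (P * A) $$ (i, j) = 0" if "j < f i" for j
    proof -
      have "j < nc" using piv(1)[OF i] that by simp
      then show ?thesis using piv(2)[OF i that] i dR dC by (subst index_map_mat(1)) auto
    qed
    assume fi: "f i < nc"
    show "?h (P * A) $$ (i, f i) = 1"
      using piv(4)[OF i fi] i fi dR dC by (subst index_map_mat(1)) auto
    show "?h (P * A) $$ (i', f i) = 0" if "i' < nr" "i' \<noteq> i" for i'
      using piv(5)[OF i fi that] that fi dR dC by (subst index_map_mat(1)) auto
  qed
  have hPA: "?h P * ?h A = ?h (P * A)" using P A by (simp add: of_real_hom.mat_hom_mult)
  have hQP: "?h Q * ?h P = 1\<^sub>m nr"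
    by (simp only: QP of_real_hom.mat_hom_mult[OF Q P, symmetric] of_real_hom.mat_hom_one)
  have "mat_kernel (?h (P * A)) = mat_kernel (?h A)"
    unfolding hPA[symmetric] by (rule mat_kernel_mult_eq[of _ nr nc _ "?h Q"]) (use A P Q hQP in auto)
  then have "kernel_dim (?h A) = kernel_dim (?h (P * A))"
    using A PA by (intro kernel_dim_cong[of _ nr nc _ nr]) auto
  also have "\<dots> = kernel_dim (P * A)"
    using kernel_dim_pivot_fun[OF _ hf, of nr] kernel_dim_pivot_fun[OF PA f] PA by simp
  also have "\<dots> = kernel_dim A"
    using mat_kernel_mult_eq[OF A P Q QP] A PA by (intro kernel_dim_cong[of _ nr nc _ nr]) auto
  finally show ?thesis .
qed

lemma kernel_dim_eq_1:
  assumes A: "A \<in> carrier_mat nr nc" and u: "u \<in> mat_kernel A" "u \<noteq> 0\<^sub>v nc"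
    and line: "\<And>v. v \<in> mat_kernel A \<Longrightarrow> \<exists>c. v = c \<cdot>\<^sub>v u"
  shows "kernel_dim A = 1"
proof -
  interpret kernel nr nc A by unfold_locales (rule A)
  have sub: "{u} \<subseteq> mat_kernel A" and uc: "{u} \<subseteq> carrier_vec nc"
    using u A by (auto simp: mat_kernel)
  have "span {u} = mat_kernel A"
  proof
    show "span {u} \<subseteq> mat_kernel A" using sub by (rule Ker.span_is_subset2)
    show "mat_kernel A \<subseteq> span {u}"
    proof
      fix v assume "v \<in> mat_kernel A"
      with line obtain c where "v = c \<cdot>\<^sub>v u" by blast
      then show "v \<in> span {u}"
        unfolding span_same[OF sub] using NC.smult_in_span[OF uc] NC.span_mem[OF uc] by auto
    qed
  qed
  then show ?thesis unfolding kernel_dim using u by (intro Ker.dim1I[of u]) auto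
qed

text \<open>
  The dimension of the kernel of the \<open>r\<close>-th power of \<open>A - a\<close> is the sum of \<open>min r s\<close> over the
  sizes \<open>s\<close> of the blocks for \<open>a\<close>; so it stops growing only when no block exceeds \<open>r\<close>.
\<close>

lemma sum_list_min_Suc_eq:
  assumes "(\<Sum>s\<leftarrow>xs. min (Suc r) s) = (\<Sum>s\<leftarrow>xs. min r s)" and "x \<in> set xs"
  shows "x \<le> r"
  using assms
proof (induction xs)
  case (Cons y ys)
  have "(\<Sum>s\<leftarrow>ys. min r s) \<le> (\<Sum>s\<leftarrow>ys. min (Suc r) s)" by (rule sum_list_mono) auto
  with Cons show ?case by (auto simp: min_def split: if_splits)
qed simp

lemma jordan_nf_block_size_le:
  assumes A: "A \<in> carrier_mat n n" and J: "jordan_nf A J" and s: "(s, a) \<in> set J"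
    and ker: "mat_kernel (char_matrix A a ^\<^sub>m Suc r) = mat_kernel (char_matrix A a ^\<^sub>m r)"
  shows "s \<le> r"
proof -
  have E: "char_matrix A a \<in> carrier_mat n n" using A by simp
  have "dim_gen_eigenspace A a (Suc r) = dim_gen_eigenspace A a r"
    unfolding dim_gen_eigenspace_def
    by (rule kernel_dim_cong[of _ n n _ n]) (use E ker in \<open>auto intro: pow_carrier_mat simp del: pow_mat.simps\<close>)
  then have sums: "(\<Sum>s\<leftarrow>map fst [(n, e)\<leftarrow>J . e = a]. min (Suc r) s)
      = (\<Sum>s\<leftarrow>map fst [(n, e)\<leftarrow>J . e = a]. min r s)"
    by (simp only: dim_gen_eigenspace[OF J])
  have "s \<in> set (map fst [(n, e)\<leftarrow>J . e = a])" using s by force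
  from sum_list_min_Suc_eq[OF sums this] show ?thesis .
qed

lemma jordan_nf_count_blocks:
  assumes A: "A \<in> carrier_mat n n" and J: "jordan_nf A J"
  shows "length (filter (\<lambda>b. snd b = a) J) = kernel_dim (char_matrix A a)"
proof -
  have "char_matrix A a ^\<^sub>m 1 = char_matrix A a" using A by simp
  then have "kernel_dim (char_matrix A a) = dim_gen_eigenspace A a 1"
    unfolding dim_gen_eigenspace_def by metis
  also have "\<dots> = (\<Sum>s\<leftarrow>map fst [(n, e)\<leftarrow>J . e = a]. min 1 s)" by (rule dim_gen_eigenspace[OF J])
  also have "\<dots> = length (filter (\<lambda>b. snd b = a) J)"
  proof -
    have "0 \<notin> fst ` set J" using J by (simp add: jordan_nf_def)
    then show ?thesis by (induction J) auto
  qed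
  finally show ?thesis by simp
qed

lemma jordan_matrix_unit_block:
  assumes "(1, a) \<in> set J"
  shows "\<exists>p < sum_list (map fst J). \<forall>j < sum_list (map fst J).
    jordan_matrix J $$ (p, j) = (if j = p then a else 0) \<and>
    jordan_matrix J $$ (j, p) = (if j = p then a else 0)"
  using assms
proof (induction J)
  case (Cons b J)
  obtain s e where b: "b = (s, e)" by force
  show ?case
  proof (cases "b = (1, a)")
    case True
    then show ?thesis by (intro exI[of _ 0]) (auto simp: jordan_matrix_Cons)
  next
    case False
    with Cons.prems have "(1, a) \<in> set J" by auto
    from Cons.IH[OF this] obtain p where p: "p < sum_list (map fst J)" and
      *: "\<forall>j < sum_list (map fst J). jordan_matrix J $$ (p, j) = (if j = p then a else 0) \<and>
        jordan_matrix J $$ (j, p) = (if j = p then a else 0)" by blast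
    show ?thesis
      by (rule exI[of _ "s + p"]) (use p * in \<open>auto simp: b jordan_matrix_Cons\<close>)
  qed
qed simp

text \<open>
  A block of size \<open>1\<close> is a row and a column of \<open>A - a\<close>, in Jordan coordinates, that are both zero.  The
  column yields a kernel vector, which cannot lie in the image because the row vanishes.
\<close>

lemma jordan_nf_no_unit_block:
  assumes A: "A \<in> carrier_mat n n" and J: "jordan_nf A J"
    and img: "\<And>u. u \<in> mat_kernel (char_matrix A a) \<Longrightarrow>
      \<exists>v \<in> carrier_vec n. char_matrix A a *\<^sub>v v = u"
  shows "(1, a) \<notin> set J"
proof
  assume "(1, a) \<in> set J"
  from jordan_matrix_unit_block[OF this] obtain p where p: "p < sum_list (map fst J)"
    and pj: "\<And>j. j < sum_list (map fst J) \<Longrightarrow> jordan_matrix J $$ (p, j) = (if j = p then a else 0)"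
      "\<And>j. j < sum_list (map fst J) \<Longrightarrow> jordan_matrix J $$ (j, p) = (if j = p then a else 0)"
    by blast
  from J obtain P Q where wit: "similar_mat_wit A (jordan_matrix J) P Q"
    by (auto simp: jordan_nf_def similar_mat_def)
  let ?E = "char_matrix A a" and ?M = "char_matrix (jordan_matrix J) a"
  from similar_mat_witD2[OF A wit] have dim: "sum_list (map fst J) = n"
    by (metis carrier_matD(1) jordan_matrix_dim(1))
  have wE: "similar_mat_wit ?E ?M P Q" by (rule similar_mat_wit_char_matrix[OF wit])
  have E: "?E \<in> carrier_mat n n" using A by simp
  from similar_mat_witD2[OF E wE] have QP: "Q * P = 1\<^sub>m n" and EM: "?E = P * ?M * Q"
    and M: "?M \<in> carrier_mat n n" and P: "P \<in> carrier_mat n n" and Q: "Q \<in> carrier_mat n n" by auto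
  have M_row: "?M $$ (p, j) = 0" "?M $$ (j, p) = 0" if "j < n" for j
    using that p pj[of j] dim by (auto simp: char_matrix_def)
  let ?e = "unit_vec n p :: 'a vec"
  have Me: "?M *\<^sub>v ?e = 0\<^sub>v n"
    using M p dim M_row by (intro eq_vecI) (auto simp: mult_mat_vec_def)
  have E_P: "?E *\<^sub>v (P *\<^sub>v x) = P *\<^sub>v (?M *\<^sub>v x)" if "x \<in> carrier_vec n" for x
  proof -
    have "?E *\<^sub>v (P *\<^sub>v x) = P *\<^sub>v (?M *\<^sub>v (Q *\<^sub>v (P *\<^sub>v x)))"
      unfolding EM using that P Q M by (simp add: assoc_mult_mat_vec[of _ n n _ n])
    also have "Q *\<^sub>v (P *\<^sub>v x) = x"
      using that P Q QP by (simp flip: assoc_mult_mat_vec[of _ n n _ n])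
    finally show ?thesis .
  qed
  have "P *\<^sub>v ?e \<in> mat_kernel ?E"
    using E P M Me E_P[of ?e] by (intro mat_kernelI[of _ n n]) auto
  from img[OF this] obtain v where v: "v \<in> carrier_vec n" and Ev: "?E *\<^sub>v v = P *\<^sub>v ?e" by blast
  have "?e = Q *\<^sub>v (P *\<^sub>v ?e)"
    using P Q QP by (simp flip: assoc_mult_mat_vec[of _ n n _ n])
  also have "\<dots> = Q *\<^sub>v (P *\<^sub>v (?M *\<^sub>v (Q *\<^sub>v v)))"
    unfolding Ev[symmetric] EM using v P Q M by (simp add: assoc_mult_mat_vec[of _ n n _ n])
  also have "\<dots> = ?M *\<^sub>v (Q *\<^sub>v v)"
    using v P Q M QP by (simp flip: assoc_mult_mat_vec[of Q n n P n])
  finally have "?e $ p = row ?M p \<bullet> (Q *\<^sub>v v)" using M p dim by simp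
  also have "\<dots> = 0"
    using M Q v p dim M_row by (auto simp: scalar_prod_def)
  finally show False using p dim by simp
qed

lemma diagonal_jordan_matrix_iff:
  fixes J :: "(nat \<times> 'a::zero_neq_one) list"
  shows "diagonal_mat (jordan_matrix J) \<longleftrightarrow> (\<forall>b \<in> set J. fst b \<le> 1)"
proof (induction J)
  case Nil
  show ?case by (simp add: diagonal_mat_def)
next
  case (Cons b J)
  obtain s e where b: "b = (s, e)" by force
  let ?M = "jordan_matrix (b # J)" and ?d = "sum_list (map fst J)"
  have block: "diagonal_mat (jordan_block s e) \<longleftrightarrow> s \<le> 1"
  proof
    assume *: "diagonal_mat (jordan_block s e)"
    show "s \<le> 1"
    proof (rule ccontr)
      assume "\<not> s \<le> 1"
      then have "jordan_block s e $$ (0, 1) = 1" "1 < s" by auto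
      moreover from this have "jordan_block s e $$ (0, 1) = 0"
        using *[unfolded diagonal_mat_def, rule_format, of 0 1] by simp
      ultimately show False by simp
    qed
  qed (auto simp: diagonal_mat_def)
  have "diagonal_mat ?M \<longleftrightarrow> diagonal_mat (jordan_block s e) \<and> diagonal_mat (jordan_matrix J)"
  proof (intro iffI conjI)
    assume M: "diagonal_mat ?M"
    have *: "?M $$ (i, j) = 0" if "i < s + ?d" "j < s + ?d" "i \<noteq> j" for i j
      using M that by (auto simp: diagonal_mat_def b)
    show "diagonal_mat (jordan_block s e)" unfolding diagonal_mat_def
    proof (intro allI impI)
      fix i j assume "i < dim_row (jordan_block s e)" "j < dim_col (jordan_block s e)" "i \<noteq> j"
      then show "jordan_block s e $$ (i, j) = 0"
        using *[of i j] by (simp add: b jordan_matrix_Cons jordan_block_def)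
    qed
    show "diagonal_mat (jordan_matrix J)" unfolding diagonal_mat_def
    proof (intro allI impI)
      fix i j assume "i < dim_row (jordan_matrix J)" "j < dim_col (jordan_matrix J)" "i \<noteq> j"
      then show "jordan_matrix J $$ (i, j) = 0"
        using *[of "s + i" "s + j"] by (simp add: b jordan_matrix_Cons jordan_block_def)
    qed
  next
    assume "diagonal_mat (jordan_block s e) \<and> diagonal_mat (jordan_matrix J)"
    then show "diagonal_mat ?M"
      by (auto simp: diagonal_mat_def b jordan_matrix_Cons jordan_block_def)
  qed
  then show ?case by (simp add: block Cons.IH b)
qed

lemma jordan_nf_eigenvalue_iff:
  fixes A :: "'a::field mat"
  assumes A: "A \<in> carrier_mat n n" and J: "jordan_nf A J"
  shows "eigenvalue A a \<longleftrightarrow> a \<in> snd ` set J"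
proof -
  have "char_poly A \<noteq> 0" using degree_monic_char_poly[OF A] by auto
  then have "eigenvalue A a \<longleftrightarrow> Polynomial.order a (char_poly A) \<noteq> 0"
    using eigenvalue_root_char_poly[OF A] order_root by blast
  also have "\<dots> \<longleftrightarrow> a \<in> snd ` set J"
    unfolding jordan_nf_order[OF J] using J by (force simp: jordan_nf_def)
  finally show ?thesis .
qed

lemma jordan_nf_order_unit_blocks:
  fixes A :: "'a::field mat"
  assumes A: "A \<in> carrier_mat n n" and J: "jordan_nf A J"
    and unit: "\<And>s. (s, a) \<in> set J \<Longrightarrow> s = 1"
  shows "Polynomial.order a (char_poly A) = kernel_dim (char_matrix A a)"
proof -
  have "sum_list (map fst (filter (\<lambda>b. snd b = a) J)) = length (filter (\<lambda>b. snd b = a) J)"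
    using unit by (induction J) auto
  then show ?thesis by (simp add: jordan_nf_order[OF J] jordan_nf_count_blocks[OF A J])
qed

section \<open>Roots of the equation linking the spectra of C and N\<close>

lemma lambda_sum: "lambda1 \<phi> + lambda2 \<phi> = 4 * \<phi> - 2"
  by (simp add: lambda1_def lambda2_def)

lemma lambda_prod:
  assumes "1 \<le> \<phi>" shows "lambda1 \<phi> * lambda2 \<phi> = 1"
proof -
  have "(sqrt (\<phi> * (\<phi> - 1)))\<^sup>2 = \<phi> * (\<phi> - 1)" using assms by simp
  then show ?thesis unfolding lambda1_def lambda2_def by (simp add: algebra_simps power2_eq_square)
qed

lemma lambda_root:
  assumes "1 \<le> \<phi>"
  shows "(lambda1 \<phi> + 1)\<^sup>2 = 4 * \<phi> * lambda1 \<phi>" "(lambda2 \<phi> + 1)\<^sup>2 = 4 * \<phi> * lambda2 \<phi>"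
proof -
  have *: "(x + 1)\<^sup>2 = 4 * \<phi> * x" if "x + y = 4 * \<phi> - 2" "x * y = 1" for x y :: real
  proof -
    have "4 * \<phi> * x = (x + y + 2) * x" using that by simp
    also have "\<dots> = (x + 1)\<^sup>2" using that(2) by (simp add: algebra_simps power2_eq_square)
    finally show ?thesis by simp
  qed
  show "(lambda1 \<phi> + 1)\<^sup>2 = 4 * \<phi> * lambda1 \<phi>" "(lambda2 \<phi> + 1)\<^sup>2 = 4 * \<phi> * lambda2 \<phi>"
    using *[of "lambda1 \<phi>" "lambda2 \<phi>"] *[of "lambda2 \<phi>" "lambda1 \<phi>"] lambda_sum[of \<phi>] lambda_prod[OF assms]
    by (simp_all add: add.commute mult.commute)
qed

lemma lambda1_mono:
  assumes "1 \<le> \<mu>" "\<mu> < \<phi>" shows "lambda1 \<mu> < lambda1 \<phi>"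
proof -
  have "\<mu> * (\<mu> - 1) \<le> \<phi> * (\<phi> - 1)" using assms by (intro mult_mono) auto
  then have "sqrt (\<mu> * (\<mu> - 1)) \<le> sqrt (\<phi> * (\<phi> - 1))" by simp
  with assms(2) show ?thesis unfolding lambda1_def by linarith
qed

lemma lambda_bounds:
  assumes "1 < \<phi>" shows "1 < lambda1 \<phi>" "0 < lambda2 \<phi>" "lambda2 \<phi> < 1" "lambda2 \<phi> = 1 / lambda1 \<phi>"
proof -
  show 1: "1 < lambda1 \<phi>" using lambda1_mono[of 1 \<phi>] assms by (simp add: lambda1_def)
  show eq: "lambda2 \<phi> = 1 / lambda1 \<phi>" using lambda_prod[of \<phi>] 1 assms by (simp add: field_simps)
  show "0 < lambda2 \<phi>" "lambda2 \<phi> < 1" unfolding eq using 1 by auto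
qed

text \<open>
  For \<open>0 \<le> \<mu> \<le> 1\<close> the roots are \<open>c \<plusminus> \<i> d\<close> with \<open>c = 2 \<mu> - 1\<close> and \<open>c\<^sup>2 + d\<^sup>2 = 1\<close>.
\<close>

lemma root_unit_circle:
  fixes a :: complex
  assumes a: "(a + 1)\<^sup>2 = 4 * of_real \<mu> * a" and \<mu>: "0 \<le> \<mu>" "\<mu> \<le> 1"
  shows "cmod a = 1"
proof -
  define c d where "c = 2 * \<mu> - 1" and "d = 2 * sqrt (\<mu> * (1 - \<mu>))"
  have "(sqrt (\<mu> * (1 - \<mu>)))\<^sup>2 = \<mu> * (1 - \<mu>)" using \<mu> by simp
  then have d2: "d\<^sup>2 = 1 - c\<^sup>2" unfolding c_def d_def power_mult_distrib
    by (simp add: algebra_simps power2_eq_square)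
  have "(a - of_real c)\<^sup>2 = a\<^sup>2 - 2 * of_real c * a + of_real (c\<^sup>2)"
    by (simp add: power2_eq_square algebra_simps)
  also have "a\<^sup>2 - 2 * of_real c * a = - 1"
    using a by (simp add: c_def power2_eq_square algebra_simps)
  also have "- 1 + of_real (c\<^sup>2) = (\<i> * of_real d)\<^sup>2"
    by (simp add: power_mult_distrib d2 flip: of_real_power)
  finally have "a - of_real c = \<i> * of_real d \<or> a - of_real c = - (\<i> * of_real d)"
    by (simp only: power2_eq_iff)
  then have "a = of_real c + \<i> * of_real d \<or> a = of_real c - \<i> * of_real d"
    by (auto simp: algebra_simps)
  then have "(cmod a)\<^sup>2 = c\<^sup>2 + d\<^sup>2" by (auto simp: cmod_power2)
  then show ?thesis using d2 by (simp add: power2_eq_1_iff) (use norm_ge_zero[of a] in linarith)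
qed

lemma root_real:
  fixes a :: complex
  assumes a: "(a + 1)\<^sup>2 = 4 * of_real \<mu> * a" and \<mu>: "1 \<le> \<mu>"
  shows "a = of_real (lambda1 \<mu>) \<or> a = of_real (lambda2 \<mu>)"
proof -
  have "(a - of_real (lambda1 \<mu>)) * (a - of_real (lambda2 \<mu>))
      = a\<^sup>2 - of_real (lambda1 \<mu> + lambda2 \<mu>) * a + of_real (lambda1 \<mu> * lambda2 \<mu>)"
    by (simp add: power2_eq_square algebra_simps)
  also have "\<dots> = 0"
    unfolding lambda_sum lambda_prod[OF \<mu>] using a by (simp add: power2_eq_square algebra_simps)
  finally show ?thesis by auto
qed

text \<open>
  The roots for \<open>\<mu> \<le> 1\<close> lie on the unit circle, and those for \<open>\<mu> > 1\<close> are real, with \<open>\<lambda>\<^sub>1\<close>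
  increasing in \<open>\<mu>\<close> and \<open>\<lambda>\<^sub>2 < 1\<close>.
\<close>

lemma root_less_lambda1:
  fixes a :: complex
  assumes a: "(a + 1)\<^sup>2 = 4 * of_real \<mu> * a" and \<mu>: "0 \<le> \<mu>" "\<mu> \<le> \<phi>" and \<phi>: "1 < \<phi>"
    and ne: "a \<noteq> of_real (lambda1 \<phi>)"
  shows "cmod a < lambda1 \<phi>"
proof (cases "\<mu> \<le> 1")
  case True
  then show ?thesis using root_unit_circle[OF a] \<mu> lambda_bounds(1)[OF \<phi>] by simp
next
  case False
  then have l: "1 < lambda1 \<mu>" "0 < lambda2 \<mu>" "lambda2 \<mu> < 1" using lambda_bounds[of \<mu>] by auto
  from root_real[OF a] False consider "a = of_real (lambda1 \<mu>)" | "a = of_real (lambda2 \<mu>)" by fastforce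
  then show ?thesis
  proof cases
    case 1
    with ne \<mu> have "\<mu> < \<phi>" by (cases "\<mu> = \<phi>") auto
    then show ?thesis using 1 l False lambda1_mono[of \<mu> \<phi>] by simp
  next
    case 2
    then show ?thesis using l lambda_bounds(1)[OF \<phi>] by simp
  qed
qed

text \<open>
  Taking inverses permutes the roots for each \<open>\<mu>\<close> and exchanges \<open>\<lambda>\<^sub>1\<close> and \<open>\<lambda>\<^sub>2\<close>.
\<close>

lemma lambda2_less_root:
  fixes a :: complex
  assumes a: "(a + 1)\<^sup>2 = 4 * of_real \<mu> * a" "a \<noteq> 0" and \<mu>: "0 \<le> \<mu>" "\<mu> \<le> \<phi>" and \<phi>: "1 < \<phi>"
    and ne: "a \<noteq> of_real (lambda2 \<phi>)"
  shows "lambda2 \<phi> < cmod a"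
proof -
  have "(1 / a + 1)\<^sup>2 = (a + 1)\<^sup>2 / a\<^sup>2" using a(2) by (simp add: field_simps power2_eq_square)
  also have "\<dots> = 4 * of_real \<mu> * (1 / a)" using a by (simp add: power2_eq_square)
  finally have "(1 / a + 1)\<^sup>2 = 4 * of_real \<mu> * (1 / a)" .
  moreover have "1 / a \<noteq> of_real (lambda1 \<phi>)"
    using ne a(2) lambda_bounds(1,4)[OF \<phi>] by (auto simp: field_simps)
  ultimately have "cmod (1 / a) < lambda1 \<phi>" using root_less_lambda1 \<mu> \<phi> by blast
  then show ?thesis
    unfolding lambda_bounds(4)[OF \<phi>] using a(2) lambda_bounds(1)[OF \<phi>]
    by (simp add: norm_divide field_simps)
qed

section \<open>Vectors as functions on indices\<close>

text \<open>
  The matrix \<open>N\<close> is real but acts on real as well as on complex vectors.  Vectors are functions on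
  the natural numbers, so that operator identities become equations between functions, free of
  side conditions about dimensions.
\<close>

definition act :: "nat \<Rightarrow> (nat \<Rightarrow> nat \<Rightarrow> real) \<Rightarrow> (nat \<Rightarrow> 'a::real_algebra_1) \<Rightarrow> nat \<Rightarrow> 'a" where
  "act n N f i = (\<Sum>j<n. of_real (N i j) * f j)"

lemma act_add: "act n N (\<lambda>i. f i + g i) = (\<lambda>i. act n N f i + act n N g i)"
  by (simp add: act_def fun_eq_iff distrib_left sum.distrib)

lemma act_diff: "act n N (\<lambda>i. f i - g i) = (\<lambda>i. act n N f i - act n N g i)"
  by (simp add: act_def fun_eq_iff right_diff_distrib sum_subtractf)

lemma act_scale:
  fixes c :: "'a::{real_algebra_1, comm_ring_1}"
  shows "act n N (\<lambda>i. c * f i) = (\<lambda>i. c * act n N f i)"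
  by (simp add: act_def fun_eq_iff sum_distrib_left mult.left_commute)

lemma act_zero [simp]: "act n N (\<lambda>i. 0) = (\<lambda>i. 0)"
  by (simp add: act_def fun_eq_iff)

lemma act_cong: "(\<And>j. j < n \<Longrightarrow> f j = g j) \<Longrightarrow> act n N f = act n N g"
  by (simp add: act_def fun_eq_iff)

lemma act_of_real: "act n N (\<lambda>i. of_real (g i)) = (\<lambda>i. of_real (act n N g i))"
  by (simp add: act_def fun_eq_iff)

definition entries :: "'a::zero vec \<Rightarrow> nat \<Rightarrow> 'a" where
  "entries v i = (if i < dim_vec v then v $ i else 0)"

lemma entries_vec: "(\<And>i. n \<le> i \<Longrightarrow> f i = 0) \<Longrightarrow> entries (vec n f) = f"
  by (auto simp: entries_def fun_eq_iff)

lemma entries_zero [simp]: "entries (0\<^sub>v n) = (\<lambda>i. 0)"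
  by (auto simp: entries_def fun_eq_iff)

lemma entries_smult: "entries (c \<cdot>\<^sub>v v) = (\<lambda>i. c * entries v i)"
  for c :: "'a::semiring_0"
  by (auto simp: entries_def fun_eq_iff)

lemma entries_eq_iff:
  "v \<in> carrier_vec n \<Longrightarrow> u \<in> carrier_vec n \<Longrightarrow> entries v = entries u \<longleftrightarrow> v = u"
  by (auto simp: entries_def fun_eq_iff intro!: eq_vecI)

lemma entries_mult_mat_vec:
  fixes v :: "'a::{real_algebra_1, comm_ring_1} vec"
  assumes M: "M \<in> carrier_mat n n" and v: "v \<in> carrier_vec n"
    and entry: "\<And>i j. i < n \<Longrightarrow> j < n \<Longrightarrow> M $$ (i, j) = (if i = j then d i else 0) + b i * N i j"
  shows "entries (map_mat of_real M *\<^sub>v v) =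
    (\<lambda>i. if i < n then of_real (d i) * entries v i + of_real (b i) * act n N (entries v) i else 0)"
proof
  fix i
  show "entries (map_mat of_real M *\<^sub>v v) i =
    (if i < n then of_real (d i) * entries v i + of_real (b i) * act n N (entries v) i else 0)"
  proof (cases "i < n")
    case True
    have "entries (map_mat of_real M *\<^sub>v v) i = (\<Sum>j<n. of_real (M $$ (i, j)) * v $ j)"
      using True M v by (auto simp: entries_def scalar_prod_def atLeast0LessThan intro!: sum.cong)
    also have "\<dots> = (\<Sum>j<n. (if i = j then of_real (d i) * v $ j else 0)
        + of_real (b i) * (of_real (N i j) * v $ j))"
      using True by (intro sum.cong) (auto simp: entry algebra_simps)
    also have "\<dots> = of_real (d i) * v $ i + of_real (b i) * (\<Sum>j<n. of_real (N i j) * v $ j)"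
      using True by (simp add: sum.distrib sum_distrib_left)
    also have "(\<Sum>j<n. of_real (N i j) * v $ j) = act n N (entries v) i"
      using v by (auto simp: act_def entries_def intro!: sum.cong)
    finally show ?thesis using True v by (simp add: entries_def)
  qed (use M in \<open>simp add: entries_def\<close>)
qed

lemma sum_lessThan_add: "(\<Sum>j<m + k. f j) = (\<Sum>j<m. f j) + (\<Sum>j<k. f (m + j))"
  for f :: "nat \<Rightarrow> 'a::comm_monoid_add"
  by (induction k) (simp_all add: add.assoc)

section \<open>The Coxeter operator of a bipartite weighted matrix\<close>

lemma compact_pointwise:
  fixes S :: "nat \<Rightarrow> real set"
  assumes "\<And>i. compact (S i)"
  shows "compact {f. \<forall>i. f i \<in> S i}"
proof -
  have "compactin (product_topology (\<lambda>i. euclidean) UNIV) (PiE UNIV S)"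
    using assms by (simp add: compactin_PiE)
  then show ?thesis by (simp add: euclidean_product_topology PiE_UNIV_domain Pi_def)
qed

text \<open>
  The function \<open>z\<close> is the sign that distinguishes the two classes of vertices, and \<open>irreducible\<close> says that
  the graph is connected.  The entries of \<open>N\<close> outside the \<open>n \<times> n\<close> square vanish, which makes
  \<open>act n N f\<close> vanish from \<open>n\<close> on.
\<close>

locale bipartite_weights =
  fixes n :: nat and N :: "nat \<Rightarrow> nat \<Rightarrow> real" and w z :: "nat \<Rightarrow> real"
  assumes N_outside: "n \<le> i \<or> n \<le> j \<Longrightarrow> N i j = 0"
    and w_pos: "i < n \<Longrightarrow> 0 < w i"
    and balanced: "i < n \<Longrightarrow> j < n \<Longrightarrow> w i * N i j = w j * N j i"
    and sign: "z i = 1 \<or> z i = - 1"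
    and bipartite: "N i j \<noteq> 0 \<Longrightarrow> z j = - z i"
    and nonpos: "N i j \<le> 0"
    and irreducible: "i < n \<Longrightarrow> j < n \<Longrightarrow> (i, j) \<in> {(i, j). N i j \<noteq> 0}\<^sup>*"
begin

abbreviation A :: "(nat \<Rightarrow> complex) \<Rightarrow> nat \<Rightarrow> complex" where "A \<equiv> act n N"

lemma w_nonneg: "i < n \<Longrightarrow> 0 \<le> w i"
  using w_pos less_imp_le by blast

abbreviation zc :: "nat \<Rightarrow> complex" where "zc i \<equiv> of_real (z i)"

text \<open>
  With the diagonal matrix \<open>Z\<close> of the signs, \<open>- Z - (1 + Z) N\<close> and \<open>Z - (1 - Z) N\<close> are the
  products \<open>w1\<close> and \<open>w2\<close> of the simple reflections in one class of vertices.
\<close>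

definition refl1 :: "(nat \<Rightarrow> complex) \<Rightarrow> nat \<Rightarrow> complex" where
  "refl1 f i = - zc i * f i - (1 + zc i) * A f i"

definition refl2 :: "(nat \<Rightarrow> complex) \<Rightarrow> nat \<Rightarrow> complex" where
  "refl2 f i = zc i * f i - (1 - zc i) * A f i"

definition cox :: "(nat \<Rightarrow> complex) \<Rightarrow> nat \<Rightarrow> complex" where
  "cox f = refl1 (refl2 f)"

text \<open>
  These functions are the vectors of length \<open>n\<close>, continued by zero.
\<close>

definition inside :: "(nat \<Rightarrow> complex) \<Rightarrow> bool" where
  "inside f \<longleftrightarrow> (\<forall>i\<ge>n. f i = 0)"

subsection \<open>Operator identities\<close>

text \<open>
  Moving the sign past \<open>N\<close> reverses it, because every edge joins vertices of different classes.
\<close>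

lemma act_sign:
  "act n N (\<lambda>i. (a + b * of_real (z i)) * f i) i = (a - b * of_real (z i)) * act n N f i"
  for f :: "nat \<Rightarrow> 'a::{real_algebra_1, comm_ring_1}"
proof -
  have "of_real (N i j) * ((a + b * of_real (z j)) * f j) = (a - b * of_real (z i)) * (of_real (N i j) * f j)" for j
    using bipartite[of i j] by (cases "N i j = 0") (auto simp: algebra_simps)
  then show ?thesis by (simp add: act_def sum_distrib_left)
qed

lemma act_flip: "act n N (\<lambda>i. of_real (z i) * f i) = (\<lambda>i. - of_real (z i) * act n N f i)"
  for f :: "nat \<Rightarrow> 'a::{real_algebra_1, comm_ring_1}"
  using act_sign[of 0 1 f] by (simp add: fun_eq_iff)

lemma act_inside [simp]: "n \<le> i \<Longrightarrow> act n N f i = 0"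
  by (simp add: act_def N_outside)

lemma inside_A [simp]: "inside (A f)" by (simp add: inside_def)

text \<open>
  This is \<open>C = 2 (1 + Z) N\<^sup>2 + 2 Z N - 1\<close>.  The coefficients keep the form \<open>a + b z\<close>, in which
  \<open>act_sign\<close> moves them past \<open>N\<close>.
\<close>

lemma cox_apply:
  "cox f i = (2 + 2 * zc i) * A (A f) i + ((0 + 2 * zc i) * A f i - f i)"
proof -
  have "A (refl2 f) i = A (\<lambda>i. (0 + 1 * zc i) * f i - (1 + (-1) * zc i) * A f i) i"
    by (simp add: refl2_def[abs_def])
  also have "\<dots> = (0 - 1 * zc i) * A f i - (1 - (-1) * zc i) * A (A f) i"
    by (simp only: act_diff act_sign)
  finally have Ar: "A (refl2 f) i = (0 - 1 * zc i) * A f i - (1 - (-1) * zc i) * A (A f) i" .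
  have "cox f i = - zc i * refl2 f i - (1 + zc i) * A (refl2 f) i" by (simp add: cox_def refl1_def)
  then show ?thesis unfolding Ar unfolding refl2_def using sign[of i] by (auto simp: algebra_simps)
qed

lemma act_cox: "A (cox f) i = (2 - 2 * zc i) * A (A (A f)) i + ((0 - 2 * zc i) * A (A f) i - A f i)"
  unfolding cox_apply act_add act_diff act_sign ..

lemma square_cox: "A (A (cox f)) = cox (A (A f))"
proof -
  have "A (cox f) = (\<lambda>i. (2 + (-2) * zc i) * A (A (A f)) i + ((0 + (-2) * zc i) * A (A f) i - A f i))"
    by (rule ext) (simp add: act_cox)
  then show ?thesis
    by (simp only: act_add act_diff act_sign) (simp add: cox_apply[abs_def])
qed

text \<open>
  The identity \<open>(C + 1)\<^sup>2 = 4 N\<^sup>2 C\<close>, the source of all spectral information on \<open>C\<close>.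
\<close>

lemma cox_square: "cox (cox f) i + 2 * cox f i + f i = 4 * A (A (cox f)) i"
  unfolding cox_apply[of "cox f"] square_cox act_cox
  unfolding cox_apply using sign[of i] by (auto simp: algebra_simps)

lemma cox_diff: "cox (\<lambda>i. f i - g i) = (\<lambda>i. cox f i - cox g i)"
  by (simp add: cox_apply fun_eq_iff act_diff algebra_simps)

lemma cox_scale: "cox (\<lambda>i. c * f i) = (\<lambda>i. c * cox f i)"
  by (simp add: cox_apply fun_eq_iff act_scale algebra_simps)

lemma cox_zero [simp]: "cox (\<lambda>i. 0) = (\<lambda>i. 0)"
  by (simp add: cox_apply fun_eq_iff)

lemma cox_eq_0: assumes "cox f = (\<lambda>i. 0)" shows "f = (\<lambda>i. 0)"
  using cox_square[of f] assms by (simp add: fun_eq_iff)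

subsection \<open>The self-adjoint square\<close>

definition herm :: "(nat \<Rightarrow> complex) \<Rightarrow> (nat \<Rightarrow> complex) \<Rightarrow> complex" where
  "herm f g = (\<Sum>i<n. of_real (w i) * (f i * cnj (g i)))"

lemma herm_act: "herm (A f) g = herm f (A g)"
proof -
  have "herm (A f) g = (\<Sum>i<n. \<Sum>j<n. of_real (w i * N i j) * (f j * cnj (g i)))"
    by (simp add: herm_def act_def sum_distrib_left sum_distrib_right mult_ac)
  also have "\<dots> = (\<Sum>i<n. \<Sum>j<n. of_real (w j * N j i) * (f j * cnj (g i)))"
    by (intro sum.cong refl) (simp only: lessThan_iff balanced)
  also have "\<dots> = (\<Sum>j<n. \<Sum>i<n. of_real (w j * N j i) * (f j * cnj (g i)))"
    by (rule sum.swap)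
  also have "\<dots> = herm f (A g)"
    by (simp add: herm_def act_def sum_distrib_left sum_distrib_right mult_ac)
  finally show ?thesis .
qed

lemma herm_diff_left: "herm (\<lambda>i. f i - g i) h = herm f h - herm g h"
  by (simp add: herm_def algebra_simps sum_subtractf)

lemma herm_scale_left: "herm (\<lambda>i. c * f i) h = c * herm f h"
  by (simp add: herm_def sum_distrib_left mult_ac)

lemma herm_scale_right: "herm f (\<lambda>i. c * h i) = cnj c * herm f h"
  by (simp add: herm_def sum_distrib_left mult_ac)

lemma herm_self: "herm f f = of_real (\<Sum>i<n. w i * (cmod (f i))\<^sup>2)"
  unfolding herm_def of_real_sum of_real_mult complex_norm_square ..

lemma inside_nonzeroE:
  assumes "inside f" "f \<noteq> (\<lambda>i. 0)"
  obtains i where "i < n" "f i \<noteq> 0"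
  using assms unfolding inside_def fun_eq_iff not_le[symmetric] by blast

lemma herm_self_pos:
  assumes "inside f" "f \<noteq> (\<lambda>i. 0)"
  shows "\<exists>r>0. herm f f = of_real r"
proof -
  from assms obtain i where i: "i < n" "f i \<noteq> 0" by (rule inside_nonzeroE)
  have "0 < (\<Sum>i<n. w i * (cmod (f i))\<^sup>2)"
  proof (rule sum_pos2[of _ i])
    show "0 \<le> w j * (cmod (f j))\<^sup>2" if "j \<in> {..<n}" for j using w_pos[of j] that by simp
  qed (use i w_pos in auto)
  then show ?thesis unfolding herm_self by blast
qed

text \<open>
  For a self-adjoint operator \<open>Q\<close> and \<open>g = (Q - a) f\<close> with \<open>Q g = a g\<close>, the number \<open>a\<close> is real unless
  \<open>g = 0\<close>, and then \<open>\<langle>g, g\<rangle> = \<langle>f, (Q - a) g\<rangle> = 0\<close>.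
\<close>

lemma square_semisimple:
  assumes f: "inside f" and
    g: "A (A (\<lambda>i. A (A f) i - a * f i)) = (\<lambda>i. a * (A (A f) i - a * f i))"
  shows "A (A f) = (\<lambda>i. a * f i)"
proof (rule ccontr)
  define g where "g = (\<lambda>i. A (A f) i - a * f i)"
  assume "A (A f) \<noteq> (\<lambda>i. a * f i)"
  then have "g \<noteq> (\<lambda>i. 0)" by (auto simp: g_def fun_eq_iff)
  moreover have "inside g" using f by (simp add: g_def inside_def)
  ultimately obtain r where r: "r > 0" "herm g g = of_real r" using herm_self_pos by blast
  have Qg: "A (A g) = (\<lambda>i. a * g i)" using g by (simp add: g_def)
  have "herm (A (A g)) g = herm g (A (A g))" by (simp only: herm_act)
  then have "a * herm g g = cnj a * herm g g"
    by (simp only: Qg herm_scale_left herm_scale_right)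
  then have a: "cnj a = a" using r by simp
  have "herm g g = herm (A (A f)) g - a * herm f g"
    by (subst (1) g_def) (simp only: herm_diff_left herm_scale_left)
  also have "herm (A (A f)) g = herm f (A (A g))" by (simp only: herm_act)
  also have "\<dots> = a * herm f g" by (simp only: Qg herm_scale_right a)
  finally show False using r by simp
qed

lemma square_eigenvalue_nonneg:
  assumes "inside g" "g \<noteq> (\<lambda>i. 0)" and Qg: "A (A g) = (\<lambda>i. a * g i)"
  shows "\<exists>\<mu>\<ge>0. a = of_real \<mu>"
proof -
  obtain r where r: "r > 0" "herm g g = of_real r" using herm_self_pos assms(1,2) by blast
  have "a * herm g g = herm (A (A g)) g" by (simp only: Qg herm_scale_left)
  also have "\<dots> = herm (A g) (A g)" by (rule herm_act)
  also have "\<dots> = of_real (\<Sum>i<n. w i * (cmod (A g i))\<^sup>2)" by (rule herm_self)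
  finally have "a = of_real ((\<Sum>i<n. w i * (cmod (A g i))\<^sup>2) / r)"
    using r by (simp add: field_simps)
  moreover have "0 \<le> (\<Sum>i<n. w i * (cmod (A g i))\<^sup>2) / r"
    using r w_pos by (intro divide_nonneg_pos sum_nonneg mult_nonneg_nonneg) (auto intro: less_imp_le)
  ultimately show ?thesis by blast
qed

subsection \<open>Semidefiniteness and positive eigenvectors\<close>

text \<open>
  Positive semidefiniteness of the self-adjoint operator \<open>c + N\<close> for the weighted inner product.
\<close>

definition psd :: "real \<Rightarrow> bool" where
  "psd c \<longleftrightarrow> (\<forall>g :: nat \<Rightarrow> real. 0 \<le> (\<Sum>i<n. w i * (g i * (c * g i + act n N g i))))"

lemma psd_eigenvalue_bound:
  assumes psd: "psd c" and f: "inside f" "f \<noteq> (\<lambda>i. 0)" and Af: "A f = (\<lambda>i. - of_real r * f i)"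
  shows "r \<le> c"
proof -
  have act_Re: "act n N (\<lambda>j. Re (f j)) i = - r * Re (f i)"
    and act_Im: "act n N (\<lambda>j. Im (f j)) i = - r * Im (f i)" for i
    using arg_cong[OF fun_cong[OF Af, of i], of Re] arg_cong[OF fun_cong[OF Af, of i], of Im]
    by (simp_all add: act_def)
  have "0 \<le> (\<Sum>i<n. w i * (Re (f i) * (c * Re (f i) + act n N (\<lambda>j. Re (f j)) i)))"
    using psd by (simp add: psd_def)
  moreover have "0 \<le> (\<Sum>i<n. w i * (Im (f i) * (c * Im (f i) + act n N (\<lambda>j. Im (f j)) i)))"
    using psd by (simp add: psd_def)
  ultimately have "0 \<le> (\<Sum>i<n. w i * (Re (f i) * (c * Re (f i) - r * Re (f i))))
      + (\<Sum>i<n. w i * (Im (f i) * (c * Im (f i) - r * Im (f i))))"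
    by (simp add: act_Re act_Im)
  also have "\<dots> = (\<Sum>i<n. w i * ((c - r) * (cmod (f i))\<^sup>2))"
    unfolding sum.distrib[symmetric]
    by (intro sum.cong refl) (simp only: cmod_power2, simp add: algebra_simps power2_eq_square)
  also have "\<dots> = (c - r) * (\<Sum>i<n. w i * (cmod (f i))\<^sup>2)"
    by (simp add: sum_distrib_left mult_ac)
  finally have "0 \<le> (c - r) * (\<Sum>i<n. w i * (cmod (f i))\<^sup>2)" .
  moreover obtain t where "t > 0" "herm f f = of_real t" using herm_self_pos f by blast
  then have "0 < (\<Sum>i<n. w i * (cmod (f i))\<^sup>2)" by (simp only: herm_self of_real_eq_iff)
  ultimately show ?thesis by (simp add: zero_le_mult_iff)
qed

lemma flip_eq_0: "(\<lambda>i. of_real (z i) * f i) = (\<lambda>i. 0) \<longleftrightarrow> f = (\<lambda>i. 0)"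
  for f :: "nat \<Rightarrow> complex"
proof -
  have "z i \<noteq> 0" for i using sign[of i] by auto
  then show ?thesis by (simp add: fun_eq_iff)
qed

text \<open>
  If \<open>N\<^sup>2 g = r\<^sup>2 g\<close>, then \<open>(N - r) g\<close> is an eigenvector of \<open>N\<close> for \<open>- r\<close>, unless it vanishes; in that
  case \<open>N g = r g\<close>, and \<open>Z g\<close> is an eigenvector for \<open>- r\<close>.
\<close>

lemma square_eigenvalue_bound:
  assumes psd: "psd c" and g: "inside g" "g \<noteq> (\<lambda>i. 0)"
    and Qg: "A (A g) = (\<lambda>i. of_real \<mu> * g i)" and \<mu>: "0 \<le> \<mu>"
  shows "sqrt \<mu> \<le> c"
proof -
  define r where "r = sqrt \<mu>"
  have r: "of_real r * of_real r = (of_real \<mu> :: complex)"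
    using \<mu> by (simp add: r_def flip: of_real_mult)
  define f where "f = (\<lambda>i. A g i - of_real r * g i)"
  have f_in: "inside f" using g by (simp add: f_def inside_def)
  have Af: "A f = (\<lambda>i. - of_real r * f i)"
    unfolding f_def act_diff act_scale Qg by (simp add: fun_eq_iff algebra_simps r flip: r)
  show ?thesis
  proof (cases "f = (\<lambda>i. 0)")
    case False
    then show ?thesis using psd_eigenvalue_bound[OF psd f_in _ Af] r_def by simp
  next
    case True
    then have "A g = (\<lambda>i. of_real r * g i)" by (simp add: f_def fun_eq_iff)
    then have "A (\<lambda>i. zc i * g i) = (\<lambda>i. - of_real r * (zc i * g i))"
      by (simp add: act_flip fun_eq_iff)
    moreover have "inside (\<lambda>i. zc i * g i)" using g by (simp add: inside_def)
    ultimately show ?thesis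
      using psd_eigenvalue_bound[OF psd, of "\<lambda>i. zc i * g i" r] g r_def by (simp add: flip_eq_0)
  qed
qed

text \<open>
  A semidefinite quadratic form that vanishes at \<open>g\<close> is minimal there, so its derivative in every
  direction \<open>h\<close> is zero.  The direction \<open>h = (c + N) g\<close> gives the claim.
\<close>

lemma psd_null_vector:
  fixes g :: "nat \<Rightarrow> real"
  assumes psd: "psd c" and null: "(\<Sum>i<n. w i * (g i * (c * g i + act n N g i))) \<le> 0" and i: "i < n"
  shows "c * g i + act n N g i = 0"
proof -
  let ?L = "\<lambda>g i. c * g i + act n N g i"
  define bil where "bil g h = (\<Sum>i<n. w i * (g i * ?L h i))" for g h :: "nat \<Rightarrow> real"
  have sym: "bil g h = bil h g" for g h
  proof -
    have "(\<Sum>i<n. w i * (g i * act n N h i)) = (\<Sum>i<n. \<Sum>j<n. (w i * N i j) * (g i * h j))"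
      by (simp add: act_def sum_distrib_left mult_ac)
    also have "\<dots> = (\<Sum>i<n. \<Sum>j<n. (w j * N j i) * (g i * h j))"
      by (intro sum.cong refl) (simp only: lessThan_iff balanced)
    also have "\<dots> = (\<Sum>j<n. \<Sum>i<n. (w j * N j i) * (g i * h j))" by (rule sum.swap)
    also have "\<dots> = (\<Sum>j<n. w j * (h j * act n N g j))"
      by (simp add: act_def sum_distrib_left mult_ac)
    finally show ?thesis unfolding bil_def by (simp add: algebra_simps sum.distrib)
  qed
  have null': "bil g g = 0" using psd null by (simp add: bil_def psd_def order_antisym)
  define h where "h = ?L g"
  have expand: "bil (\<lambda>i. g i + t * h i) (\<lambda>i. g i + t * h i) = 2 * t * bil h g + t\<^sup>2 * bil h h" for t
  proof -
    have "bil (\<lambda>i. g i + t * h i) (\<lambda>i. g i + t * h i)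
        = bil g g + t * bil h g + t * bil g h + t\<^sup>2 * bil h h"
      unfolding bil_def act_add act_scale
      by (simp add: algebra_simps sum.distrib sum_distrib_left power2_eq_square)
    then show ?thesis using sym[of g h] null' by simp
  qed
  define b where "b = bil h g"
  define p where "p = bil h h"
  have p: "0 \<le> p" using psd by (simp add: p_def bil_def psd_def)
  \<comment> \<open>The value of \<open>t\<close> used below is a downhill step that is short enough for the linear term to
    dominate the quadratic one.\<close>
  have "0 \<le> bil (\<lambda>i. g i + t * h i) (\<lambda>i. g i + t * h i)" for t
    using psd by (simp add: bil_def psd_def)
  then have "0 \<le> 2 * (- b / (p + 1)) * b + (- b / (p + 1))\<^sup>2 * p"
    unfolding expand b_def p_def by blast
  also have "\<dots> = - b\<^sup>2 * (p + 2) / (p + 1)\<^sup>2"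
    using p by (simp add: divide_simps power2_eq_square) (simp add: algebra_simps)
  finally have "b\<^sup>2 * (p + 2) / (p + 1)\<^sup>2 \<le> 0" by simp
  then have "b = 0" using p
    by (smt (verit) divide_pos_pos mult_pos_pos zero_less_power2)
  then have "(\<Sum>i<n. w i * (h i * h i)) = 0" by (simp add: b_def bil_def h_def)
  then have "w i * (h i * h i) = 0"
    using i by (subst (asm) sum_nonneg_eq_0_iff) (auto simp: zero_le_mult_iff w_nonneg)
  then show ?thesis using w_pos[OF i] by (simp add: h_def)
qed

text \<open>
  As \<open>N\<close> is nonpositive, passing from \<open>f\<close> to \<open>\<bar>f\<bar>\<close> does not increase the form of \<open>c + N\<close>, so
  \<open>\<bar>f\<bar>\<close> is also in the kernel.  At a zero of \<open>\<bar>f\<bar>\<close> the equation is a sum of terms of one sign, which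
  forces zeros at all neighbours and, by connectedness, everywhere.
\<close>

lemma perron_no_zero:
  assumes psd: "psd c" and Af: "A f = (\<lambda>i. - of_real c * f i)" and f: "inside f"
    and i: "i < n" "f i = 0"
  shows "f = (\<lambda>i. 0)"
proof -
  let ?g = "\<lambda>i. cmod (f i)"
  have le: "?g i * (c * ?g i + act n N ?g i) \<le> 0" for i
  proof -
    have "?g i * act n N ?g i = (\<Sum>j<n. N i j * (?g i * ?g j))"
      by (simp add: act_def sum_distrib_left mult_ac)
    also have "\<dots> \<le> (\<Sum>j<n. N i j * Re (f j * cnj (f i)))"
    proof (rule sum_mono, rule mult_left_mono_neg)
      fix j
      have "Re (f j * cnj (f i)) \<le> cmod (f j * cnj (f i))" by (rule complex_Re_le_cmod)
      then show "Re (f j * cnj (f i)) \<le> ?g i * ?g j" by (simp add: norm_mult mult.commute)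
    qed (rule nonpos)
    also have "\<dots> = Re (A f i * cnj (f i))"
      by (simp only: act_def sum_distrib_right Re_sum) (simp add: algebra_simps)
    also have "\<dots> = - c * (?g i)\<^sup>2"
      unfolding Af cmod_power2 by (simp add: power2_eq_square algebra_simps)
    finally show ?thesis by (simp add: algebra_simps power2_eq_square)
  qed
  have "(\<Sum>i<n. w i * (?g i * (c * ?g i + act n N ?g i))) \<le> 0"
    using le w_pos by (intro sum_nonpos) (simp add: mult_nonneg_nonpos less_imp_le)
  then have ker: "c * ?g i + act n N ?g i = 0" if "i < n" for i
    using psd_null_vector[OF psd _ that, of ?g] by blast
  have step: "?g k = 0" if "?g j = 0" "N j k \<noteq> 0" for j k
  proof -
    have jk: "j < n" "k < n" using that N_outside[of j k] by (auto simp: not_le[symmetric])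
    have "(\<Sum>k<n. - (N j k * ?g k)) = 0" using ker[OF jk(1)] that by (simp add: act_def sum_negf)
    then have "- (N j k * ?g k) = 0" using jk nonpos[of j]
      by (subst (asm) sum_nonneg_eq_0_iff) (auto simp: mult_nonpos_nonneg)
    with that show ?thesis by simp
  qed
  have "f k = 0" if "k < n" for k
    using irreducible[OF i(1) that] by (induction rule: rtrancl_induct) (use i step in auto)
  then show ?thesis using f by (auto simp: inside_def fun_eq_iff not_le[symmetric])
qed

text \<open>
  A suitable combination of two kernel vectors has a zero entry and therefore vanishes.
\<close>

lemma perron_line:
  assumes psd: "psd c" and u: "inside u" "u \<noteq> (\<lambda>i. 0)" "A u = (\<lambda>i. - of_real c * u i)"
    and g: "inside g" "A g = (\<lambda>i. - of_real c * g i)"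
  shows "\<exists>a. g = (\<lambda>i. a * u i)"
proof -
  from u(1,2) obtain k where k: "k < n" "u k \<noteq> 0" by (rule inside_nonzeroE)
  define a where "a = g k / u k"
  let ?f = "\<lambda>i. g i - a * u i"
  have "?f = (\<lambda>i. 0)"
  proof (rule perron_no_zero[OF psd _ _ k(1)])
    show "A ?f = (\<lambda>i. - of_real c * ?f i)"
      by (simp add: act_diff act_scale u g fun_eq_iff algebra_simps)
  qed (use k u g in \<open>simp_all add: inside_def a_def\<close>)
  then show ?thesis by (intro exI[of _ a]) (simp add: fun_eq_iff)
qed

text \<open>
  The quadratic form of \<open>N\<close> attains its minimum \<open>- s\<close> on the unit sphere, which is compact, and a
  minimizer is a null vector of the semidefinite form of \<open>s + N\<close>.
\<close>

lemma lowest_eigenvalue: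
  assumes n: "0 < n"
  shows "\<exists>s u. psd s \<and> (\<forall>i\<ge>n. u i = 0) \<and> u \<noteq> (\<lambda>i. 0) \<and>
    act n N u = (\<lambda>i. - s * (u i :: real))"
proof -
  define q where "q g = (\<Sum>i<n. w i * (g i * act n N g i))" for g :: "nat \<Rightarrow> real"
  define t where "t g = (\<Sum>i<n. w i * (g i)\<^sup>2)" for g :: "nat \<Rightarrow> real"
  define S where "S = {g :: nat \<Rightarrow> real. (\<forall>i\<ge>n. g i = 0) \<and> t g = 1}"
  \<comment> \<open>The weighted unit sphere is a closed subset of a box.\<close>
  define box where "box i = (if i < n then {- sqrt (1 / w i) .. sqrt (1 / w i)} else {0})" for i
  have cont: "continuous_on UNIV t" "continuous_on UNIV q"
    unfolding t_def q_def act_def by (intro continuous_intros continuous_on_product_coordinates)+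
  have "compact {g. \<forall>i. g i \<in> box i}" by (rule compact_pointwise) (simp add: box_def)
  moreover have "closed {g. t g = 1}"
    using cont(1) by (intro closed_Collect_eq continuous_on_const) auto
  moreover have "closed {g :: nat \<Rightarrow> real. \<forall>i. n \<le> i \<longrightarrow> g i = 0}"
  proof -
    have "closed {g :: nat \<Rightarrow> real. n \<le> i \<longrightarrow> g i = 0}" for i
      by (cases "n \<le> i")
        (auto intro!: closed_Collect_eq continuous_on_const continuous_on_product_coordinates)
    then show ?thesis by (rule closed_Collect_all)
  qed
  ultimately have "compact ({g. \<forall>i. g i \<in> box i} \<inter> ({g. t g = 1} \<inter> {g. \<forall>i. n \<le> i \<longrightarrow> g i = 0}))"
    by (intro compact_Int_closed closed_Int)
  also have "{g. \<forall>i. g i \<in> box i} \<inter> ({g. t g = 1} \<inter> {g. \<forall>i. n \<le> i \<longrightarrow> g i = 0}) = S"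
  proof -
    have "g i \<in> box i" if "g \<in> S" for g i
    proof (cases "i < n")
      case True
      have "w i * (g i)\<^sup>2 \<le> t g" unfolding t_def
      proof (rule member_le_sum)
        show "0 \<le> w j * (g j)\<^sup>2" if "j \<in> {..<n} - {i}" for j using w_pos[of j] that by simp
      qed (use True in auto)
      then have "(g i)\<^sup>2 \<le> 1 / w i" using that w_pos[OF True] by (simp add: S_def field_simps)
      then have "\<bar>g i\<bar> \<le> sqrt (1 / w i)" by (rule real_le_rsqrt[of "\<bar>g i\<bar>", simplified])
      then show ?thesis using True by (auto simp: box_def)
    qed (use that in \<open>simp add: box_def S_def\<close>)
    then show ?thesis by (auto simp: S_def)
  qed
  finally have "compact S" .
  moreover have "S \<noteq> {}"
  proof -
    have "t (\<lambda>i. if i = 0 then sqrt (1 / w 0) else 0) = (\<Sum>i<n. if i = 0 then 1 else 0)"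
      unfolding t_def using w_pos[OF n] by (intro sum.cong) auto
    then have "(\<lambda>i. if i = 0 then sqrt (1 / w 0) else 0) \<in> S" using n by (auto simp: S_def)
    then show ?thesis by blast
  qed
  ultimately obtain u where u: "u \<in> S" and min: "\<And>g. g \<in> S \<Longrightarrow> q u \<le> q g"
    using continuous_attains_inf[of S q] continuous_on_subset[OF cont(2)] by blast
  have ray: "q u * t g \<le> q g" for g
  proof (cases "t g = 0")
    case True
    have "0 \<le> w i * (g i)\<^sup>2" if "i < n" for i using w_pos[OF that] by simp
    then have "w i * (g i)\<^sup>2 = 0" if "i < n" for i
      using True that unfolding t_def by (subst (asm) sum_nonneg_eq_0_iff) auto
    then have "g i = 0" if "i < n" for i using that w_pos[OF that] by force
    then show ?thesis by (simp add: q_def t_def)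
  next
    case False
    then have t: "0 < t g"
      unfolding t_def by (intro order_le_neq_trans sum_nonneg) (auto intro!: mult_nonneg_nonneg w_nonneg)
    define h where "h i = (if i < n then (1 / sqrt (t g)) * g i else 0)" for i
    have "t h = (\<Sum>i<n. (1 / t g) * (w i * (g i)\<^sup>2))"
      unfolding t_def[of h] using t by (intro sum.cong) (auto simp: h_def power_divide)
    also have "\<dots> = (1 / t g) * t g" by (simp only: t_def sum_distrib_left)
    finally have "h \<in> S" using t by (simp add: S_def h_def)
    have "act n N h = act n N (\<lambda>i. (1 / sqrt (t g)) * g i)"
      by (rule act_cong) (simp add: h_def)
    then have "act n N h = (\<lambda>i. (1 / sqrt (t g)) * act n N g i)" by (simp only: act_scale)
    then have "q h = (\<Sum>i<n. (1 / t g) * (w i * (g i * act n N g i)))"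
      unfolding q_def using t by (intro sum.cong) (auto simp: h_def field_simps simp flip: power2_eq_square)
    also have "\<dots> = (1 / t g) * q g" by (simp only: q_def sum_distrib_left)
    finally have "q h * t g = q g" using t by simp
    then show ?thesis using mult_right_mono[OF min[OF \<open>h \<in> S\<close>], of "t g"] t by simp
  qed
  define s where "s = - q u"
  have expand: "(\<Sum>i<n. w i * (g i * (s * g i + act n N g i))) = s * t g + q g" for g
    by (simp add: t_def q_def algebra_simps sum.distrib sum_distrib_left power2_eq_square)
  have psd: "psd s" unfolding psd_def expand using ray by (simp add: s_def)
  have "(\<Sum>i<n. w i * (u i * (s * u i + act n N u i))) \<le> 0"
    unfolding expand using u by (simp add: s_def S_def)
  from psd_null_vector[OF psd this] have "act n N u i = - s * u i" for i
    using u by (cases "i < n") (auto simp: S_def eq_neg_iff_add_eq_0 add.commute)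
  moreover have "u \<noteq> (\<lambda>i. 0)" using u by (auto simp: S_def t_def)
  ultimately show ?thesis using psd u by (intro exI[of _ s] exI[of _ u]) (auto simp: S_def)
qed

subsection \<open>Generalized eigenvectors of the Coxeter operator\<close>

lemma cox_eigenvector_square:
  assumes "cox f = (\<lambda>i. a * f i)"
  shows "4 * a * A (A f) i = (a + 1)\<^sup>2 * f i"
  using cox_square[of f, of i]
  by (simp add: assms cox_scale act_scale algebra_simps power2_eq_square)

lemma cox_eigenvector:
  assumes f: "inside f" "f \<noteq> (\<lambda>i. 0)" and Cf: "cox f = (\<lambda>i. a * f i)"
  shows "a \<noteq> 0" and "\<exists>\<mu>\<ge>0. (a + 1)\<^sup>2 = 4 * of_real \<mu> * a \<and> A (A f) = (\<lambda>i. of_real \<mu> * f i)"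
proof -
  show a: "a \<noteq> 0" using cox_eq_0[of f] Cf f(2) by auto
  note eq = cox_eigenvector_square[OF Cf]
  have Q: "A (A f) = (\<lambda>i. (a + 1)\<^sup>2 / (4 * a) * f i)"
    using eq a by (simp add: fun_eq_iff field_simps)
  from square_eigenvalue_nonneg[OF f Q] obtain \<mu> where "\<mu> \<ge> 0" "(a + 1)\<^sup>2 / (4 * a) = of_real \<mu>"
    by blast
  with Q a show "\<exists>\<mu>\<ge>0. (a + 1)\<^sup>2 = 4 * of_real \<mu> * a \<and> A (A f) = (\<lambda>i. of_real \<mu> * f i)"
    by (intro exI[of _ \<mu>]) (auto simp: field_simps)
qed

definition cox_minus :: "complex \<Rightarrow> (nat \<Rightarrow> complex) \<Rightarrow> nat \<Rightarrow> complex" where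
  "cox_minus a f i = cox f i - a * f i"

lemma cox_minus_cox: "cox_minus a (cox f) = cox (cox_minus a f)"
  by (simp add: cox_minus_def[abs_def] cox_diff cox_scale)

lemma cox_minus_scale: "cox_minus a (\<lambda>i. c * f i) = (\<lambda>i. c * cox_minus a f i)"
  by (simp add: cox_minus_def[abs_def] cox_scale algebra_simps)

lemma cox_minus_zero [simp]: "cox_minus a (\<lambda>i. 0) = (\<lambda>i. 0)"
  by (simp add: cox_minus_def[abs_def])

definition square_minus :: "complex \<Rightarrow> (nat \<Rightarrow> complex) \<Rightarrow> nat \<Rightarrow> complex" where
  "square_minus a f i = A (A f) i - a * f i"

lemma square_minus_cox: "square_minus a (cox f) = cox (square_minus a f)"
  by (simp add: square_minus_def[abs_def] cox_diff cox_scale square_cox)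

lemma square_minus_semisimple:
  assumes "inside f" "square_minus a (square_minus a f) = (\<lambda>i. 0)"
  shows "square_minus a f = (\<lambda>i. 0)"
proof -
  have "A (A f) = (\<lambda>i. a * f i)"
    by (rule square_semisimple[OF assms(1)])
      (use assms(2) in \<open>simp add: square_minus_def[abs_def] fun_eq_iff\<close>)
  then show ?thesis by (simp add: square_minus_def[abs_def])
qed

text \<open>
  With \<open>m = (a + 1)\<^sup>2 / (4 a)\<close>, the identity \<open>(C + 1)\<^sup>2 = 4 N\<^sup>2 C\<close> factors as
  \<open>4 C (N\<^sup>2 - m) = (C - 1 / a) (C - a)\<close>.
\<close>

lemma cox_square_minus:
  assumes "4 * a * m = (a + 1)\<^sup>2" "a \<noteq> 0"
  shows "4 * cox (square_minus m f) i = cox_minus (1 / a) (cox_minus a f) i"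
proof -
  have m: "4 * m = a + 2 + 1 / a"
    using assms by (simp add: field_simps power2_eq_square)
  have "4 * cox (square_minus m f) i = 4 * A (A (cox f)) i - 4 * m * cox f i"
    by (simp add: square_minus_cox[symmetric] square_minus_def algebra_simps)
  also have "\<dots> = cox (cox f) i + 2 * cox f i + f i - 4 * m * cox f i"
    by (simp only: cox_square)
  also have "\<dots> = cox_minus (1 / a) (cox_minus a f) i"
    unfolding m using assms(2) by (simp add: cox_minus_def[abs_def] cox_diff cox_scale field_simps)
  finally show ?thesis .
qed

lemma cox_minus_commute: "cox_minus a (cox_minus b f) = cox_minus b (cox_minus a f)"
  by (simp add: cox_minus_def[abs_def] cox_diff cox_scale algebra_simps)

text \<open>
  A vector killed by \<open>(C - a)\<^sup>2\<close> is killed by \<open>(N\<^sup>2 - m)\<^sup>2\<close>, hence by \<open>N\<^sup>2 - m\<close>, hence by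
  \<open>(C - 1 / a) (C - a)\<close>.  The two factors are different unless \<open>a = - 1\<close>; then \<open>m = 0\<close>, and
  \<open>N\<^sup>2 f = 0\<close> implies \<open>N f = 0\<close>, so that \<open>C f = - f\<close>.
\<close>

lemma cox_minus_kernel_square:
  assumes f: "inside f" and "a \<noteq> 1" and ff: "cox_minus a (cox_minus a f) = (\<lambda>i. 0)"
  shows "cox_minus a f = (\<lambda>i. 0)"
proof (cases "a = 0")
  case True
  then have "cox_minus a = cox" by (simp add: cox_minus_def[abs_def] fun_eq_iff)
  then show ?thesis using ff cox_eq_0 by metis
next
  case False
  define m where "m = (a + 1)\<^sup>2 / (4 * a)"
  have m: "4 * a * m = (a + 1)\<^sup>2" using False by (simp add: m_def)
  have "4 * (4 * cox (cox (square_minus m (square_minus m f))) i) = cox_minus (1 / a) (cox_minus (1 / a) (cox_minus a (cox_minus a f))) i" for i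
  proof -
    have "(\<lambda>i. 4 * cox (square_minus m (square_minus m f)) i) = cox_minus (1 / a) (cox_minus a (square_minus m f))"
      using cox_square_minus[OF m False] by auto
    then have "cox (\<lambda>i. 4 * cox (square_minus m (square_minus m f)) i) i = cox_minus (1 / a) (cox_minus a (cox (square_minus m f))) i"
      by (simp only: cox_minus_cox)
    then have "4 * (4 * cox (cox (square_minus m (square_minus m f))) i) = 4 * cox_minus (1 / a) (cox_minus a (cox (square_minus m f))) i"
      by (simp only: cox_scale)
    also have "\<dots> = cox_minus (1 / a) (cox_minus a (\<lambda>i. 4 * cox (square_minus m f) i)) i"
      by (simp add: cox_minus_def[abs_def] cox_diff cox_scale algebra_simps)
    also have "(\<lambda>i. 4 * cox (square_minus m f) i) = cox_minus (1 / a) (cox_minus a f)"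
      using cox_square_minus[OF m False] by auto
    finally show ?thesis by (simp only: cox_minus_commute[of a "1 / a"])
  qed
  then have "cox (cox (square_minus m (square_minus m f))) = (\<lambda>i. 0)" by (simp add: ff fun_eq_iff)
  then have "square_minus m (square_minus m f) = (\<lambda>i. 0)" using cox_eq_0 by blast
  then have square_minus: "square_minus m f = (\<lambda>i. 0)" using square_minus_semisimple f by blast
  show ?thesis
  proof (cases "a = - 1")
    case True
    then have "m = 0" by (simp add: m_def)
    with square_minus have QQ: "A (A f) = (\<lambda>i. 0)" by (simp add: square_minus_def[abs_def])
    have "A f = (\<lambda>i. 0)"
    proof (rule ccontr)
      assume "A f \<noteq> (\<lambda>i. 0)"
      then obtain r where "r > 0" "herm (A f) (A f) = of_real r" using herm_self_pos inside_A by blast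
      moreover have "herm (A f) (A f) = herm (A (A f)) f" by (rule herm_act[symmetric])
      ultimately show False by (simp add: QQ herm_def)
    qed
    then show ?thesis using True by (simp add: cox_minus_def[abs_def] cox_apply)
  next
    case a: False
    define g where "g = cox_minus a f"
    have "cox_minus (1 / a) g = (\<lambda>i. 0)" using cox_square_minus[OF m False, of f] by (auto simp: square_minus g_def fun_eq_iff)
    moreover have "cox_minus a g = (\<lambda>i. 0)" using ff by (simp add: g_def)
    ultimately have "(a - 1 / a) * g i = 0" for i by (simp add: cox_minus_def fun_eq_iff algebra_simps)
    moreover have "a - 1 / a \<noteq> 0"
    proof
      assume "a - 1 / a = 0"
      then have "(a - 1) * (a + 1) = 0" using False by (simp add: field_simps)
      then show False using a assms(2) by (auto simp: eq_neg_iff_add_eq_0)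
    qed
    ultimately show ?thesis by (simp add: g_def fun_eq_iff)
  qed
qed

text \<open>
  For \<open>a = 1\<close> the factorization is \<open>4 C (N\<^sup>2 - 1) = (C - 1)\<^sup>2\<close>, so \<open>(C - 1)\<^sup>4 f = 0\<close> implies
  \<open>(N\<^sup>2 - 1)\<^sup>2 f = 0\<close> and then \<open>(C - 1)\<^sup>2 f = 0\<close>.
\<close>

lemma cox_minus_one_kernel_cube:
  assumes f: "inside f" and fff: "cox_minus 1 (cox_minus 1 (cox_minus 1 f)) = (\<lambda>i. 0)"
  shows "cox_minus 1 (cox_minus 1 f) = (\<lambda>i. 0)"
proof -
  have cox_square_minus: "cox (square_minus 1 f) = (\<lambda>i. cox_minus 1 (cox_minus 1 f) i / 4)" for f
    using cox_square_minus[of 1 1 f] by (simp add: fun_eq_iff mult.commute)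
  have "cox (cox (square_minus 1 (square_minus 1 f))) = cox (\<lambda>i. cox_minus 1 (cox_minus 1 (square_minus 1 f)) i / 4)"
    by (simp only: cox_square_minus)
  also have "\<dots> = (\<lambda>i. cox_minus 1 (cox_minus 1 (cox (square_minus 1 f))) i / 4)"
    using cox_scale[of "1/4" "cox_minus 1 (cox_minus 1 (square_minus 1 f))"] by (simp add: cox_minus_cox)
  also have "\<dots> = (\<lambda>i. 0)"
  proof -
    have "cox_minus 1 (\<lambda>i. g i / 4) = (\<lambda>i. cox_minus 1 g i / 4)" for g
      using cox_scale[of "1/4" g] by (simp add: cox_minus_def[abs_def] diff_divide_distrib)
    then show ?thesis by (simp add: cox_square_minus fff)
  qed
  finally have "square_minus 1 (square_minus 1 f) = (\<lambda>i. 0)" using cox_eq_0 by blast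
  then have "square_minus 1 f = (\<lambda>i. 0)" using square_minus_semisimple f by blast
  then have "(\<lambda>i. cox_minus 1 (cox_minus 1 f) i / 4) = (\<lambda>i. 0)" by (simp flip: cox_square_minus)
  then show ?thesis by (simp add: fun_eq_iff)
qed

lemma refl_involutive: "refl1 (refl1 f) = f"
proof
  fix i
  have "A (refl1 f) i = A (\<lambda>i. (0 + (-1) * zc i) * f i - (1 + 1 * zc i) * A f i) i"
    by (simp add: refl1_def[abs_def])
  also have "\<dots> = (0 - (-1) * zc i) * A f i - (1 - 1 * zc i) * A (A f) i"
    by (simp only: act_diff act_sign)
  finally have "A (refl1 f) i = (0 - (-1) * zc i) * A f i - (1 - 1 * zc i) * A (A f) i" .
  then show "refl1 (refl1 f) i = f i"
    unfolding refl1_def[of "refl1 f"] refl1_def[of f] using sign[of i] by (auto simp: algebra_simps)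
qed

text \<open>
  The fixed vectors of \<open>w1 w2\<close> are those on which the two involutions agree, and their difference
  \<open>w2 - w1\<close> is \<open>2 Z (1 + N)\<close>.
\<close>

lemma cox_fixed_iff: "cox_minus 1 f = (\<lambda>i. 0) \<longleftrightarrow> A f = (\<lambda>i. - f i)"
proof -
  have "cox_minus 1 f = (\<lambda>i. 0) \<longleftrightarrow> cox f = f" by (simp add: cox_minus_def fun_eq_iff)
  also have "\<dots> \<longleftrightarrow> refl2 f = refl1 f"
  proof
    assume "cox f = f"
    then have "refl1 (cox f) = refl1 f" by simp
    then show "refl2 f = refl1 f" by (simp add: cox_def refl_involutive)
  qed (simp add: cox_def refl_involutive)
  also have "\<dots> \<longleftrightarrow> (\<forall>i. zc i * (A f i + f i) = 0)"
  proof -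
    have "refl2 f i - refl1 f i = 2 * (zc i * (A f i + f i))" for i
      by (simp add: refl1_def refl2_def algebra_simps)
    then have "refl2 f i = refl1 f i \<longleftrightarrow> 2 * (zc i * (A f i + f i)) = 0" for i
      by (metis right_minus_eq)
    then show ?thesis unfolding fun_eq_iff by simp
  qed
  also have "\<dots> \<longleftrightarrow> (\<forall>i. A f i + f i = 0)"
    using flip_eq_0[of "\<lambda>i. A f i + f i"] by (simp add: fun_eq_iff)
  finally show ?thesis by (simp add: fun_eq_iff eq_neg_iff_add_eq_0)
qed

text \<open>
  For \<open>N u = - u\<close> a direct computation gives \<open>(C - 1) (Z u) = 4 u\<close>.
\<close>

lemma cox_fixed_in_range:
  assumes "cox_minus 1 u = (\<lambda>i. 0)"
  shows "cox_minus 1 (\<lambda>i. (1 / 4) * (zc i * u i)) = u"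
proof -
  have Au: "A u = (\<lambda>i. - u i)" using assms by (simp only: cox_fixed_iff)
  have "A (\<lambda>i. zc i * u i) = (\<lambda>i. zc i * u i)" by (simp add: act_flip Au)
  then have "cox (\<lambda>i. zc i * u i) i - zc i * u i = 4 * u i" for i
    unfolding cox_apply using sign[of i] by (auto simp: algebra_simps)
  then show ?thesis unfolding cox_minus_scale by (simp add: cox_minus_def fun_eq_iff)
qed

text \<open>
  The eigenvectors of \<open>C\<close> for a root \<open>a\<close> lie in the eigenspace of \<open>N\<^sup>2\<close> for \<open>s\<^sup>2\<close>.  As \<open>s + N\<close> maps
  \<open>s f - N f\<close> and \<open>Z (s f + N f)\<close> to zero there, that eigenspace is spanned by the Perron vector \<open>u\<close> and
  by \<open>Z u\<close>.  On this basis \<open>C\<close> is a \<open>2 \<times> 2\<close> matrix with nonzero off-diagonal entries, whose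
  eigenspaces are lines.
\<close>

lemma cox_line:
  assumes psd: "psd s" and s: "1 < s"
    and u: "inside u" "u \<noteq> (\<lambda>i. 0)" "A u = (\<lambda>i. - of_real s * u i)"
    and a: "(a + 1)\<^sup>2 = 4 * of_real (s\<^sup>2) * a" "a \<noteq> 0"
  shows "\<exists>v. inside v \<and> v \<noteq> (\<lambda>i. 0) \<and> cox v = (\<lambda>i. a * v i) \<and>
    (\<forall>f. inside f \<and> cox f = (\<lambda>i. a * f i) \<longrightarrow> (\<exists>c. f = (\<lambda>i. c * v i)))"
proof -
  define r :: complex where "r = of_real s"
  have r: "r \<noteq> 0" "r + 1 \<noteq> 0" "2 * r\<^sup>2 + 2 * r \<noteq> 0"
  proof -
    show "r \<noteq> 0" using s by (simp add: r_def)
    have "r + 1 = of_real (s + 1)" by (simp add: r_def)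
    then show "r + 1 \<noteq> 0" using s by (simp only: of_real_eq_0_iff)
    with \<open>r \<noteq> 0\<close> have "2 * r * (r + 1) \<noteq> 0" by simp
    then show "2 * r\<^sup>2 + 2 * r \<noteq> 0" by (simp add: algebra_simps power2_eq_square)
  qed
  have Au: "A u = (\<lambda>i. - r * u i)" using u by (simp add: r_def)
  have Az: "A (\<lambda>i. zc i * u i) = (\<lambda>i. r * (zc i * u i))" by (simp add: act_flip Au fun_eq_iff)
  \<comment> \<open>\<open>u\<close> and \<open>Z u\<close> are eigenvectors of \<open>N\<close> for the different eigenvalues \<open>- r\<close> and \<open>r\<close>.\<close>
  have indep: "b = 0 \<and> c = 0" if 0: "\<And>i. b * u i + c * (zc i * u i) = 0" for b c
  proof -
    obtain i where i: "u i \<noteq> 0" using u(2) by auto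
    have "A (\<lambda>i. b * u i + c * (zc i * u i)) i = 0" by (simp add: 0)
    moreover have "A (\<lambda>i. b * u i + c * (zc i * u i)) i = r * (c * (zc i * u i) - b * u i)"
      by (simp only: act_add act_scale Au Az) (simp add: algebra_simps)
    ultimately have "r * (c * (zc i * u i) - b * u i) = 0" by simp
    then have "c * (zc i * u i) = b * u i" using r by simp
    with 0[of i] have "b * u i = 0" "c * (zc i * u i) = 0" by auto
    then show ?thesis using i sign[of i] by auto
  qed
  have cox_comb: "cox (\<lambda>i. b * u i + c * (zc i * u i)) i =
    ((2 * r\<^sup>2 - 1) * b + (2 * r\<^sup>2 + 2 * r) * c) * u i
    + ((2 * r\<^sup>2 - 2 * r) * b + (2 * r\<^sup>2 - 1) * c) * (zc i * u i)" for b c i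
  proof -
    have A1: "A (\<lambda>i. b * u i + c * (zc i * u i)) = (\<lambda>i. (- r * b) * u i + (r * c) * (zc i * u i))"
      by (simp only: act_add act_scale Au Az) (simp add: algebra_simps)
    have A2: "A (\<lambda>i. (- r * b) * u i + (r * c) * (zc i * u i))
        = (\<lambda>i. (r * r * b) * u i + (r * r * c) * (zc i * u i))"
      by (simp only: act_add act_scale Au Az) (simp add: algebra_simps)
    show ?thesis unfolding cox_apply A1 A2
      using sign[of i] by (auto simp: algebra_simps power2_eq_square)
  qed
  \<comment> \<open>The first row of the \<open>2 \<times> 2\<close> matrix determines the slope \<open>k\<close> of the eigenvector \<open>u + k Z u\<close>; the second row holds
    because \<open>a\<close> is a root.\<close>
  define k where "k = (a + 1 - 2 * r\<^sup>2) / (2 * r\<^sup>2 + 2 * r)"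
  define v where "v = (\<lambda>i. 1 * u i + k * (zc i * u i))"
  have k1: "(2 * r\<^sup>2 - 1) * 1 + (2 * r\<^sup>2 + 2 * r) * k = a"
    using r by (simp add: k_def)
  have "(a + 1 - 2 * r\<^sup>2)\<^sup>2 = (2 * r\<^sup>2 - 2 * r) * (2 * r\<^sup>2 + 2 * r)"
    using a(1) by (simp add: r_def power2_eq_square algebra_simps)
  then have k2: "(2 * r\<^sup>2 - 2 * r) * 1 + (2 * r\<^sup>2 - 1) * k = a * k"
    using r unfolding k_def by (simp add: field_simps power2_eq_square)
  have Cv: "cox v = (\<lambda>i. a * v i)"
    unfolding v_def cox_comb[abs_def] k1 k2 by (simp add: algebra_simps)
  have "v \<noteq> (\<lambda>i. 0)" using indep[of 1 k] by (auto simp: v_def fun_eq_iff)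
  moreover have "inside v" using u by (simp add: v_def inside_def)
  moreover have "\<exists>c. f = (\<lambda>i. c * v i)" if f: "inside f" "cox f = (\<lambda>i. a * f i)" for f
  proof -
    have "(4 * a) * A (A f) i = (4 * a) * (r\<^sup>2 * f i)" for i
      using cox_eigenvector_square[OF f(2), of i] by (simp add: a(1) r_def mult_ac)
    then have Q: "A (A f) = (\<lambda>i. r\<^sup>2 * f i)" using a(2) by (simp add: fun_eq_iff)
    have "\<exists>b. (\<lambda>i. r * f i - A f i) = (\<lambda>i. b * u i)"
      by (rule perron_line[OF psd u])
        (use f in \<open>simp_all add: inside_def act_diff act_scale Q fun_eq_iff r_def algebra_simps power2_eq_square\<close>)
    moreover have "\<exists>c. (\<lambda>i. zc i * (r * f i + A f i)) = (\<lambda>i. c * u i)"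
    proof (rule perron_line[OF psd u])
      have "A (\<lambda>i. zc i * (r * f i + A f i)) = (\<lambda>i. - zc i * (r * A f i + r\<^sup>2 * f i))"
        by (simp only: act_flip act_add act_scale Q)
      then show "A (\<lambda>i. zc i * (r * f i + A f i)) = (\<lambda>i. - of_real s * (zc i * (r * f i + A f i)))"
        by (simp only: r_def) (simp add: algebra_simps power2_eq_square)
    qed (use f in \<open>simp add: inside_def\<close>)
    ultimately obtain b c where b: "\<And>i. r * f i - A f i = b * u i"
      and c: "\<And>i. zc i * (r * f i + A f i) = c * u i" unfolding fun_eq_iff by blast
    define b' c' where "b' = b / (2 * r)" and "c' = c / (2 * r)"
    have f_eq: "f i = b' * u i + c' * (zc i * u i)" for i
    proof -
      have "r * f i + A f i = zc i * (zc i * (r * f i + A f i))" using sign[of i] by auto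
      also have "\<dots> = c * (zc i * u i)" by (simp only: c) simp
      finally have "r * f i + A f i = c * (zc i * u i)" .
      with b[of i] have "(r * f i - A f i) + (r * f i + A f i) = b * u i + c * (zc i * u i)" by simp
      then have "2 * r * f i = b * u i + c * (zc i * u i)" by (simp add: mult.assoc)
      then show ?thesis using r by (simp add: b'_def c'_def field_simps)
    qed
    then have "f = (\<lambda>i. b' * u i + c' * (zc i * u i))" by auto
    then have "a * f i = cox (\<lambda>i. b' * u i + c' * (zc i * u i)) i" for i using f by simp
    then have "((2 * r\<^sup>2 - 1) * b' + (2 * r\<^sup>2 + 2 * r) * c' - a * b') * u i
        + ((2 * r\<^sup>2 - 2 * r) * b' + (2 * r\<^sup>2 - 1) * c' - a * c') * (zc i * u i) = 0" for i
      unfolding cox_comb f_eq by (simp add: algebra_simps)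
    from indep[OF this, THEN conjunct1] have "(2 * r\<^sup>2 + 2 * r) * c' = (a + 1 - 2 * r\<^sup>2) * b'"
      by (simp add: algebra_simps)
    then have "c' = b' * k" using r by (simp add: k_def field_simps)
    then show ?thesis by (intro exI[of _ b']) (simp add: fun_eq_iff f_eq v_def algebra_simps)
  qed
  ultimately show ?thesis using Cv by blast
qed

end

section \<open>The Coxeter transformation of a valued tree\<close>

text \<open>
  The hypotheses of the theorem, apart from the Jordan form.
\<close>

locale valued_tree_blocks =
  fixes K :: "int mat" and D F T B :: "real mat" and m k :: nat
  assumes cartan: "generalized_cartan_matrix (m + k) K"
    and tree: "valued_tree K"
    and D: "D \<in> carrier_mat m k" and F: "F \<in> carrier_mat k m"
    and block_form: "map_mat real_of_int K =
      four_block_mat (2 \<cdot>\<^sub>m 1\<^sub>m m) (2 \<cdot>\<^sub>m D) (2 \<cdot>\<^sub>m F) (2 \<cdot>\<^sub>m 1\<^sub>m k)"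
    and tits: "symmetrization (m + k) K T B"
begin

text \<open>
  The size is a constant of its own, as simplification would otherwise reorder the sum \<open>m + k\<close>.
\<close>

definition n :: nat where "n = m + k"

definition N :: "nat \<Rightarrow> nat \<Rightarrow> real" where
  "N i j = (if i < n \<and> j < n \<and> i \<noteq> j then K $$ (i, j) / 2 else 0)"

text \<open>
  The weights turn \<open>K = T B\<close> into the symmetric matrix \<open>B\<close>.
\<close>

definition w :: "nat \<Rightarrow> real" where "w i = 1 / T $$ (i, i)"

definition z :: "nat \<Rightarrow> real" where "z i = (if i < m then 1 else - 1)"

lemma K_entries: "K \<in> carrier_mat n n" "\<And>i. i < n \<Longrightarrow> K $$ (i, i) = 2"
  "\<And>i j. i < n \<Longrightarrow> j < n \<Longrightarrow> i \<noteq> j \<Longrightarrow> K $$ (i, j) \<le> 0"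
  "\<And>i j. i < n \<Longrightarrow> j < n \<Longrightarrow> i \<noteq> j \<Longrightarrow> K $$ (i, j) = 0 \<Longrightarrow> K $$ (j, i) = 0"
  using cartan unfolding generalized_cartan_matrix_def n_def by auto

lemma T_entries: "T \<in> carrier_mat n n" "\<And>i j. i < n \<Longrightarrow> j < n \<Longrightarrow> i \<noteq> j \<Longrightarrow> T $$ (i, j) = 0"
  "\<And>i. i < n \<Longrightarrow> 0 < T $$ (i, i)"
  and B_sym: "B \<in> carrier_mat n n" "transpose_mat B = B" and K_TB: "map_mat real_of_int K = T * B"
  using tits unfolding symmetrization_def diagonal_mat_def n_def by auto

lemma K_entry: "i < n \<Longrightarrow> j < n \<Longrightarrow> real_of_int (K $$ (i, j)) = (if i = j then 2 else 0) + 2 * N i j"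
  by (auto simp: N_def K_entries(2))

lemma K_block:
  assumes "i < n" "j < n"
  shows "real_of_int (K $$ (i, j)) =
    (if i < m then if j < m then (if i = j then 2 else 0) else 2 * D $$ (i, j - m)
     else if j < m then 2 * F $$ (i - m, j) else (if i = j then 2 else 0))"
proof -
  have "real_of_int (K $$ (i, j)) = map_mat real_of_int K $$ (i, j)" using assms K_entries(1) by simp
  also have "\<dots> = (if i < m then if j < m then (if i = j then 2 else 0) else 2 * D $$ (i, j - m)
     else if j < m then 2 * F $$ (i - m, j) else (if i = j then 2 else 0))"
    unfolding block_form using assms D F by (auto simp: n_def)
  finally show ?thesis .
qed

lemma N_block:
  assumes "i < n" "j < n"
  shows "N i j = (if i < m then if j < m then 0 else D $$ (i, j - m)
     else if j < m then F $$ (i - m, j) else 0)"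
  using K_block[OF assms] K_entry[OF assms] by (auto split: if_splits)

lemma B_entry:
  assumes "i < n" "j < n"
  shows "B $$ (i, j) = (if i = j then 2 * w i else 0) + (2 * w i) * N i j"
proof -
  have "real_of_int (K $$ (i, j)) = (T * B) $$ (i, j)" using assms K_entries(1) by (simp flip: K_TB)
  also have "\<dots> = (\<Sum>l<n. T $$ (i, l) * B $$ (l, j))"
    using assms T_entries(1) B_sym(1) by (auto simp: scalar_prod_def atLeast0LessThan intro!: sum.cong)
  also have "\<dots> = (\<Sum>l<n. if l = i then T $$ (i, i) * B $$ (i, j) else 0)"
    by (intro sum.cong) (use T_entries(2) assms in auto)
  also have "\<dots> = T $$ (i, i) * B $$ (i, j)" using assms by simp
  finally show ?thesis
    using T_entries(3)[OF assms(1)] K_entry[OF assms] by (auto simp: w_def field_simps)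
qed

lemma w_pos: "i < n \<Longrightarrow> 0 < w i" using T_entries(3) by (simp add: w_def)

lemma balanced: assumes "i < n" "j < n" shows "w i * N i j = w j * N j i"
proof (cases "i = j")
  case False
  have "B $$ (i, j) = transpose_mat B $$ (i, j)" by (simp only: B_sym(2))
  also have "\<dots> = B $$ (j, i)" using assms B_sym(1) by simp
  finally show ?thesis using False B_entry[OF assms] B_entry[OF assms(2,1)] by simp
qed simp

lemma irreducible: assumes "i < n" "j < n" shows "(i, j) \<in> {(i, j). N i j \<noteq> 0}\<^sup>*"
proof -
  let ?G = "with_proj (mk_symmetric (with_proj (valued_graph K)))"
  have "strongly_connected ?G" using tree unfolding valued_tree_def connected_def by simp
  moreover have "i \<in> verts ?G" "j \<in> verts ?G"
    using assms K_entries(1) by (auto simp: mk_symmetric_def valued_graph_def)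
  ultimately have "i \<rightarrow>\<^sup>*\<^bsub>?G\<^esub> j" unfolding strongly_connected_def by blast
  then have "(i, j) \<in> (arcs_ends ?G)\<^sup>*" by (rule reachable_rtranclI)
  moreover have "arcs_ends ?G \<subseteq> {(i, j). N i j \<noteq> 0}"
  proof
    fix e assume "e \<in> arcs_ends ?G"
    then obtain a b where "e = (a, b)" "a < n" "b < n" "a \<noteq> b" "K $$ (a, b) \<noteq> 0 \<or> K $$ (b, a) \<noteq> 0"
      using K_entries(1) by (auto simp: arcs_ends_def arc_to_ends_def mk_symmetric_def valued_graph_def)
    moreover from this have "K $$ (a, b) \<noteq> 0" using K_entries(4)[of a b] by blast
    ultimately show "e \<in> {(i, j). N i j \<noteq> 0}" by (simp add: N_def)
  qed
  ultimately show ?thesis using rtrancl_mono by blast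
qed

lemma n_pos: "0 < n"
proof -
  have "verts (with_proj (mk_symmetric (with_proj (valued_graph K)))) \<noteq> {}"
    using tree unfolding valued_tree_def connected_def strongly_connected_def by simp
  then show ?thesis using K_entries(1) by (auto simp: mk_symmetric_def valued_graph_def)
qed

sublocale bipartite_weights n N w z
proof
  fix i j
  show "n \<le> i \<or> n \<le> j \<Longrightarrow> N i j = 0" by (auto simp: N_def)
  show "z i = 1 \<or> z i = - 1" by (simp add: z_def)
  show "N i j \<noteq> 0 \<Longrightarrow> z j = - z i"
  proof -
    assume N: "N i j \<noteq> 0"
    then have "i < n" "j < n" by (auto simp: N_def split: if_splits)
    then show "z j = - z i" using N N_block[of i j] by (auto simp: z_def split: if_splits)
  qed
  show "N i j \<le> 0" using K_entries(3)[of i j] by (auto simp: N_def)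
  show "i < n \<Longrightarrow> 0 < w i" by (rule w_pos)
  show "i < n \<Longrightarrow> j < n \<Longrightarrow> w i * N i j = w j * N j i" by (rule balanced)
  show "i < n \<Longrightarrow> j < n \<Longrightarrow> (i, j) \<in> {(i, j). N i j \<noteq> 0}\<^sup>*" by (rule irreducible)
qed

abbreviation "C \<equiv> coxeter D F"

lemma carrier_w: "w1 D \<in> carrier_mat n n" "w2 F \<in> carrier_mat n n" "C \<in> carrier_mat n n"
proof -
  show "w1 D \<in> carrier_mat n n" "w2 F \<in> carrier_mat n n"
    using D F by (auto simp: w1_def w2_def Let_def n_def)
  then show "C \<in> carrier_mat n n" by (simp add: coxeter_def)
qed

lemma w1_entry: "i < n \<Longrightarrow> j < n \<Longrightarrow> w1 D $$ (i, j) = (if i = j then - z i else 0) + (- (1 + z i)) * N i j"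
  using D F by (auto simp: w1_def Let_def N_block z_def n_def)

lemma w2_entry: "i < n \<Longrightarrow> j < n \<Longrightarrow> w2 F $$ (i, j) = (if i = j then z i else 0) + (- (1 - z i)) * N i j"
  using D F by (auto simp: w2_def Let_def N_block z_def n_def)

lemma inside_entries: "v \<in> carrier_vec n \<Longrightarrow> inside (entries v)"
  by (auto simp: inside_def entries_def)

lemma entries_coxeter:
  assumes v: "v \<in> carrier_vec n"
  shows "entries (C *\<^sub>v v) = cox (entries v)"
proof -
  let ?h = "map_mat complex_of_real"
  have w2v: "?h (w2 F) *\<^sub>v v \<in> carrier_vec n" using carrier_w v by simp
  have "C *\<^sub>v v = ?h (w1 D) *\<^sub>v (?h (w2 F) *\<^sub>v v)"
    unfolding coxeter_def of_real_hom.mat_hom_mult[OF carrier_w(1,2)]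
    by (rule assoc_mult_mat_vec) (use carrier_w v in auto)
  moreover have "entries (?h (w2 F) *\<^sub>v v) = refl2 (entries v)"
  proof -
    have "entries (?h (w2 F) *\<^sub>v v) = (\<lambda>i. if i < n
        then of_real (z i) * entries v i + of_real (- (1 - z i)) * A (entries v) i else 0)"
      by (rule entries_mult_mat_vec[OF carrier_w(2) v]) (rule w2_entry)
    then show ?thesis using inside_entries[OF v] by (auto simp: refl2_def inside_def fun_eq_iff algebra_simps)
  qed
  moreover have "entries (?h (w1 D) *\<^sub>v u) = refl1 (entries u)" if u: "u \<in> carrier_vec n" for u
  proof -
    have "entries (?h (w1 D) *\<^sub>v u) = (\<lambda>i. if i < n
        then of_real (- z i) * entries u i + of_real (- (1 + z i)) * A (entries u) i else 0)"
      by (rule entries_mult_mat_vec[OF carrier_w(1) u]) (rule w1_entry)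
    then show ?thesis using inside_entries[OF u] by (auto simp: refl1_def inside_def fun_eq_iff algebra_simps)
  qed
  ultimately show ?thesis using w2v by (simp add: cox_def)
qed

lemma char_matrix_C: "char_matrix C a \<in> carrier_mat n n"
  using carrier_w(3) by simp

lemma entries_char_matrix:
  assumes v: "v \<in> carrier_vec n"
  shows "entries (char_matrix C a *\<^sub>v v) = cox_minus a (entries v)"
proof -
  have "char_matrix C a *\<^sub>v v = C *\<^sub>v v + (- a) \<cdot>\<^sub>v v"
    unfolding char_matrix_def using carrier_w(3) v
    by (intro eq_vecI) (auto simp: add_scalar_prod_distrib[of _ n])
  moreover have "entries (C *\<^sub>v v + (- a) \<cdot>\<^sub>v v) i = entries (C *\<^sub>v v) i - a * entries v i" for i
    using carrier_w(3) v by (auto simp: entries_def)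
  ultimately show ?thesis by (simp add: fun_eq_iff cox_minus_def entries_coxeter[OF v])
qed

lemma char_matrix_eq_0_iff:
  assumes "v \<in> carrier_vec n"
  shows "char_matrix C a *\<^sub>v v = 0\<^sub>v n \<longleftrightarrow> cox_minus a (entries v) = (\<lambda>i. 0)"
  using entries_eq_iff[of "char_matrix C a *\<^sub>v v" n "0\<^sub>v n"] assms char_matrix_C[of a]
  by (simp add: entries_char_matrix)

lemma mem_kernel_char_matrix:
  "v \<in> mat_kernel (char_matrix C a) \<longleftrightarrow> v \<in> carrier_vec n \<and> cox_minus a (entries v) = (\<lambda>i. 0)"
  using mat_kernel[OF char_matrix_C[of a]] char_matrix_eq_0_iff by auto

lemma mem_kernel_char_matrix_power:
  "v \<in> mat_kernel (char_matrix C a ^\<^sub>m r) \<longleftrightarrow>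
    v \<in> carrier_vec n \<and> (cox_minus a ^^ r) (entries v) = (\<lambda>i. 0)"
proof -
  let ?E = "char_matrix C a"
  note E = char_matrix_C[of a]
  have "entries (?E ^\<^sub>m r *\<^sub>v v) = (cox_minus a ^^ r) (entries v)" if "v \<in> carrier_vec n" for v
    using that
  proof (induction r arbitrary: v)
    case 0
    then show ?case using E by simp
  next
    case (Suc r)
    have "?E ^\<^sub>m Suc r *\<^sub>v v = ?E ^\<^sub>m r *\<^sub>v (?E *\<^sub>v v)"
      unfolding pow_mat.simps
      by (rule assoc_mult_mat_vec) (use E Suc.prems in auto)
    moreover have "?E *\<^sub>v v \<in> carrier_vec n" using E Suc.prems by simp
    ultimately show ?case
      using Suc by (simp add: entries_char_matrix funpow_swap1)
  qed
  moreover have P: "?E ^\<^sub>m r \<in> carrier_mat n n" using E by simp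
  moreover have "?E ^\<^sub>m r *\<^sub>v v = 0\<^sub>v n \<longleftrightarrow> entries (?E ^\<^sub>m r *\<^sub>v v) = (\<lambda>i. 0)" if "v \<in> carrier_vec n" for v
    using entries_eq_iff[OF mult_mat_vec_carrier[OF P that] zero_carrier_vec] by simp
  ultimately show ?thesis unfolding mat_kernel[OF P] by auto
qed

lemma eigenvalue_C_iff:
  "eigenvalue C a \<longleftrightarrow> (\<exists>f. inside f \<and> f \<noteq> (\<lambda>i. 0) \<and> cox f = (\<lambda>i. a * f i))"
proof -
  have cox_minus: "cox_minus a f = (\<lambda>i. 0) \<longleftrightarrow> cox f = (\<lambda>i. a * f i)" for f
    by (simp add: cox_minus_def fun_eq_iff)
  show ?thesis
  proof
    assume "eigenvalue C a"
    then obtain v where v: "v \<in> carrier_vec n" "v \<noteq> 0\<^sub>v n" "char_matrix C a *\<^sub>v v = 0\<^sub>v n"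
      using eigenvalue_char_matrix[OF carrier_w(3)] by blast
    moreover have "entries v \<noteq> (\<lambda>i. 0)" using v entries_eq_iff[of v n "0\<^sub>v n"] by simp
    ultimately show "\<exists>f. inside f \<and> f \<noteq> (\<lambda>i. 0) \<and> cox f = (\<lambda>i. a * f i)"
      using inside_entries char_matrix_eq_0_iff cox_minus by blast
  next
    assume "\<exists>f. inside f \<and> f \<noteq> (\<lambda>i. 0) \<and> cox f = (\<lambda>i. a * f i)"
    then obtain f where f: "inside f" "f \<noteq> (\<lambda>i. 0)" "cox f = (\<lambda>i. a * f i)" by blast
    have e: "entries (vec n f) = f" by (rule entries_vec) (use f in \<open>simp add: inside_def\<close>)
    have "char_matrix C a *\<^sub>v vec n f = 0\<^sub>v n"
      using char_matrix_eq_0_iff[of "vec n f" a] f cox_minus by (simp add: e)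
    moreover have "vec n f \<noteq> 0\<^sub>v n" using e f(2) entries_zero[of n] by metis
    ultimately show "eigenvalue C a" unfolding eigenvalue_char_matrix[OF carrier_w(3)]
      by (intro exI[of _ "vec n f"]) simp
  qed
qed

lemma entries_B:
  fixes v :: "'a::{real_algebra_1, comm_ring_1} vec"
  assumes v: "v \<in> carrier_vec n"
  shows "entries (map_mat of_real B *\<^sub>v v) i = of_real (2 * w i) * (entries v i + act n N (entries v) i)"
proof (cases "i < n")
  case False
  then show ?thesis using v B_sym(1) by (simp add: entries_def)
qed (simp add: entries_mult_mat_vec[where N = N and d = "\<lambda>i. 2 * w i" and b = "\<lambda>i. 2 * w i", OF B_sym(1) v B_entry] algebra_simps)

lemma B_eq_0_iff:
  fixes v :: "'a::{real_algebra_1, comm_ring_1, idom} vec"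
  assumes v: "v \<in> carrier_vec n"
  shows "map_mat of_real B *\<^sub>v v = 0\<^sub>v n \<longleftrightarrow> act n N (entries v) = (\<lambda>i. - entries v i)"
proof -
  have Bv: "map_mat of_real B *\<^sub>v v \<in> carrier_vec n" using B_sym(1) v by simp
  have *: "of_real (2 * w i) * (entries v i + act n N (entries v) i) = 0 \<longleftrightarrow>
    act n N (entries v) i = - entries v i" for i
  proof (cases "i < n")
    case True
    then have "of_real (2 * w i) \<noteq> (0 :: 'a)" using w_pos[of i] by simp
    then show ?thesis by (simp add: add_eq_0_iff)
  qed (use v in \<open>simp add: entries_def\<close>)
  have "map_mat of_real B *\<^sub>v v = 0\<^sub>v n \<longleftrightarrow> entries (map_mat of_real B *\<^sub>v v) = (\<lambda>i. 0)"
    using entries_eq_iff[OF Bv zero_carrier_vec] by simp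
  also have "\<dots> \<longleftrightarrow> act n N (entries v) = (\<lambda>i. - entries v i)"
    by (simp only: fun_eq_iff entries_B[OF v] *)
  finally show ?thesis .
qed

lemma kernel_B: "mat_kernel (map_mat complex_of_real B) = mat_kernel (char_matrix C 1)"
proof -
  have "map_mat complex_of_real B \<in> carrier_mat n n" using B_sym(1) by simp
  from mat_kernel[OF this] show ?thesis
    unfolding set_eq_iff mem_kernel_char_matrix cox_fixed_iff mem_Collect_eq using B_eq_0_iff by blast
qed

text \<open>
  The fixed vectors of \<open>C\<close> form the complex kernel of \<open>B\<close>.
\<close>

lemma kernel_dim_B: "kernel_dim (char_matrix C 1) = kernel_dim B"
proof -
  have "kernel_dim (char_matrix C 1) = kernel_dim (map_mat complex_of_real B)"
    by (rule kernel_dim_cong[of _ n n _ n]) (use char_matrix_C B_sym(1) kernel_B in auto)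
  then show ?thesis by (simp only: kernel_dim_map_of_real)
qed

subsection \<open>Forms, block sizes and extreme eigenvalues\<close>

lemma tits_form_entries:
  assumes x: "x \<in> carrier_vec n"
  shows "tits_form B x = 2 * (\<Sum>i<n. w i * (entries x i * (1 * entries x i + act n N (entries x) i)))"
proof -
  have id: "map_mat of_real B = B" by (rule eq_matI) auto
  have "tits_form B x = (\<Sum>i<n. x $ i * (B *\<^sub>v x) $ i)"
    using x B_sym(1) by (simp add: tits_form_def scalar_prod_def atLeast0LessThan)
  also have "\<dots> = (\<Sum>i<n. entries x i * entries (B *\<^sub>v x) i)"
    using x B_sym(1) by (intro sum.cong) (auto simp: entries_def)
  also have "\<dots> = (\<Sum>i<n. 2 * (w i * (entries x i * (1 * entries x i + act n N (entries x) i))))"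
    using entries_B[OF x] unfolding id by (intro sum.cong) (auto simp: algebra_simps)
  finally show ?thesis by (simp only: sum_distrib_left)
qed

text \<open>
  The Tits form is twice the weighted form of \<open>1 + N\<close>.
\<close>

lemma nonnegative_form_iff: "nonnegative_form n B \<longleftrightarrow> psd 1"
proof
  assume *: "nonnegative_form n B"
  show "psd 1" unfolding psd_def
  proof
    fix g :: "nat \<Rightarrow> real"
    have "act n N (entries (vec n g)) = act n N g"
      by (rule act_cong) (simp add: entries_def)
    then have "tits_form B (vec n g) = 2 * (\<Sum>i<n. w i * (g i * (1 * g i + act n N g i)))"
      by (simp add: tits_form_entries entries_def)
    then show "0 \<le> (\<Sum>i<n. w i * (g i * (1 * g i + act n N g i)))"
      using *[unfolded nonnegative_form_def, rule_format, of "vec n g"] by simp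
  qed
next
  assume "psd 1"
  then show "nonnegative_form n B"
    unfolding nonnegative_form_def psd_def using tits_form_entries by simp
qed

lemma nondegenerate_form_iff:
  "nondegenerate_form n B \<longleftrightarrow> (\<forall>x \<in> carrier_vec n. B *\<^sub>v x = 0\<^sub>v n \<longrightarrow> x = 0\<^sub>v n)"
proof -
  have sym: "x \<bullet> (B *\<^sub>v y) = (B *\<^sub>v x) \<bullet> y" if "x \<in> carrier_vec n" "y \<in> carrier_vec n" for x y
    using transpose_vec_mult_scalar[OF B_sym(1) that(2,1)] by (simp add: B_sym(2))
  have "(\<forall>y \<in> carrier_vec n. x \<bullet> (B *\<^sub>v y) = 0) \<longleftrightarrow> B *\<^sub>v x = 0\<^sub>v n" if x: "x \<in> carrier_vec n" for x
  proof
    assume *: "\<forall>y \<in> carrier_vec n. x \<bullet> (B *\<^sub>v y) = 0"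
    have Bx: "B *\<^sub>v x \<in> carrier_vec n" using B_sym(1) x by simp
    show "B *\<^sub>v x = 0\<^sub>v n"
    proof (rule eq_vecI)
      fix i assume "i < dim_vec (0\<^sub>v n :: real vec)"
      then have i: "i < n" by simp
      have "(B *\<^sub>v x) $ i = (B *\<^sub>v x) \<bullet> unit_vec n i" by (rule scalar_prod_right_unit[OF i, symmetric])
      also have "\<dots> = x \<bullet> (B *\<^sub>v unit_vec n i)" using sym[OF x, of "unit_vec n i"] by simp
      also have "\<dots> = 0" using * by simp
      finally show "(B *\<^sub>v x) $ i = 0\<^sub>v n $ i" using i by simp
    qed (use B_sym(1) in auto)
  qed (use sym[OF x] B_sym(1) in auto)
  then show ?thesis unfolding nondegenerate_form_def by blast
qed

text \<open>
  The real and the imaginary part of a complex kernel vector of the real matrix \<open>1 + N\<close> are kernel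
  vectors, too.
\<close>

lemma real_kernel_iff:
  "(\<exists>x \<in> carrier_vec n. B *\<^sub>v x = 0\<^sub>v n \<and> x \<noteq> 0\<^sub>v n) \<longleftrightarrow> eigenvalue C 1"
proof -
  have id: "map_mat of_real B = B" by (rule eq_matI) auto
  have "(\<exists>x \<in> carrier_vec n. B *\<^sub>v x = 0\<^sub>v n \<and> x \<noteq> 0\<^sub>v n) \<longleftrightarrow>
    (\<exists>g :: nat \<Rightarrow> real. (\<forall>i\<ge>n. g i = 0) \<and> g \<noteq> (\<lambda>i. 0) \<and> act n N g = (\<lambda>i. - g i))"
  proof
    assume "\<exists>x \<in> carrier_vec n. B *\<^sub>v x = 0\<^sub>v n \<and> x \<noteq> 0\<^sub>v n"
    then obtain x where x: "x \<in> carrier_vec n" "B *\<^sub>v x = 0\<^sub>v n" "x \<noteq> 0\<^sub>v n" by blast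
    then show "\<exists>g :: nat \<Rightarrow> real. (\<forall>i\<ge>n. g i = 0) \<and> g \<noteq> (\<lambda>i. 0) \<and> act n N g = (\<lambda>i. - g i)"
      using B_eq_0_iff[OF x(1), unfolded id] entries_eq_iff[OF x(1) zero_carrier_vec]
      by (intro exI[of _ "entries x"]) (auto simp: entries_def)
  next
    assume "\<exists>g :: nat \<Rightarrow> real. (\<forall>i\<ge>n. g i = 0) \<and> g \<noteq> (\<lambda>i. 0) \<and> act n N g = (\<lambda>i. - g i)"
    then obtain g :: "nat \<Rightarrow> real" where g: "\<And>i. n \<le> i \<Longrightarrow> g i = 0" "g \<noteq> (\<lambda>i. 0)" "act n N g = (\<lambda>i. - g i)"
      by blast
    have e: "entries (vec n g) = g" by (rule entries_vec) (rule g(1))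
    have "vec n g \<noteq> 0\<^sub>v n" using e g(2) entries_zero[of n] by metis
    moreover have "B *\<^sub>v vec n g = 0\<^sub>v n" using B_eq_0_iff[of "vec n g", unfolded id] g(3) by (simp add: e)
    ultimately show "\<exists>x \<in> carrier_vec n. B *\<^sub>v x = 0\<^sub>v n \<and> x \<noteq> 0\<^sub>v n" by (intro bexI[of _ "vec n g"]) auto
  qed
  also have "\<dots> \<longleftrightarrow> (\<exists>f. inside f \<and> f \<noteq> (\<lambda>i. 0) \<and> A f = (\<lambda>i. - f i))"
  proof
    assume "\<exists>g :: nat \<Rightarrow> real. (\<forall>i\<ge>n. g i = 0) \<and> g \<noteq> (\<lambda>i. 0) \<and> act n N g = (\<lambda>i. - g i)"
    then obtain g :: "nat \<Rightarrow> real" where g: "\<forall>i\<ge>n. g i = 0" "g \<noteq> (\<lambda>i. 0)" "act n N g = (\<lambda>i. - g i)"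
      by blast
    then show "\<exists>f. inside f \<and> f \<noteq> (\<lambda>i. 0) \<and> A f = (\<lambda>i. - f i)"
      by (intro exI[of _ "\<lambda>i. of_real (g i)"]) (auto simp: inside_def act_of_real fun_eq_iff)
  next
    assume "\<exists>f. inside f \<and> f \<noteq> (\<lambda>i. 0) \<and> A f = (\<lambda>i. - f i)"
    then obtain f where f: "inside f" "f \<noteq> (\<lambda>i. 0)" "A f = (\<lambda>i. - f i)" by blast
    have Re_Im: "act n N (\<lambda>j. Re (f j)) = (\<lambda>i. - Re (f i))" "act n N (\<lambda>j. Im (f j)) = (\<lambda>i. - Im (f i))"
      using arg_cong[OF fun_cong[OF f(3)], of Re] arg_cong[OF fun_cong[OF f(3)], of Im]
      by (simp_all add: act_def fun_eq_iff)
    have zero: "\<forall>i\<ge>n. Re (f i) = 0" "\<forall>i\<ge>n. Im (f i) = 0" using f(1) by (simp_all add: inside_def)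
    have "(\<lambda>j. Re (f j)) \<noteq> (\<lambda>i. 0) \<or> (\<lambda>j. Im (f j)) \<noteq> (\<lambda>i. 0)"
      using f(2) by (auto simp: fun_eq_iff complex_eq_iff)
    then show "\<exists>g :: nat \<Rightarrow> real. (\<forall>i\<ge>n. g i = 0) \<and> g \<noteq> (\<lambda>i. 0) \<and> act n N g = (\<lambda>i. - g i)"
    proof
      assume "(\<lambda>j. Re (f j)) \<noteq> (\<lambda>i. 0)"
      then show "\<exists>g :: nat \<Rightarrow> real. (\<forall>i\<ge>n. g i = 0) \<and> g \<noteq> (\<lambda>i. 0) \<and> act n N g = (\<lambda>i. - g i)"
        by (intro exI[of _ "\<lambda>j. Re (f j)"] conjI zero Re_Im)
    next
      assume "(\<lambda>j. Im (f j)) \<noteq> (\<lambda>i. 0)"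
      then show "\<exists>g :: nat \<Rightarrow> real. (\<forall>i\<ge>n. g i = 0) \<and> g \<noteq> (\<lambda>i. 0) \<and> act n N g = (\<lambda>i. - g i)"
        by (intro exI[of _ "\<lambda>j. Im (f j)"] conjI zero Re_Im)
    qed
  qed
  also have "\<dots> \<longleftrightarrow> eigenvalue C 1"
    unfolding eigenvalue_C_iff using cox_fixed_iff by (simp add: cox_minus_def fun_eq_iff)
  finally show ?thesis .
qed

lemma block_sizes:
  assumes J: "jordan_nf C J" and b: "(s, a) \<in> set J"
  shows "s = (if a = 1 then 2 else 1)"
proof -
  have "s \<noteq> 0" using J b by (force simp: jordan_nf_def)
  show ?thesis
  proof (cases "a = 1")
    case True
    have "s \<le> 2"
    proof (rule jordan_nf_block_size_le[OF carrier_w(3) J b])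
      show "mat_kernel (char_matrix C a ^\<^sub>m Suc 2) = mat_kernel (char_matrix C a ^\<^sub>m 2)"
        unfolding set_eq_iff mem_kernel_char_matrix_power
        using cox_minus_one_kernel_cube[OF inside_entries] True by (auto simp: numeral_2_eq_2)
    qed
    moreover have "(1, a) \<notin> set J"
    proof (rule jordan_nf_no_unit_block[OF carrier_w(3) J])
      fix u assume "u \<in> mat_kernel (char_matrix C a)"
      then have u: "u \<in> carrier_vec n" "cox_minus 1 (entries u) = (\<lambda>i. 0)"
        using True mem_kernel_char_matrix by auto
      let ?g = "\<lambda>i. (1 / 4) * (zc i * entries u i)"
      have e: "entries (vec n ?g) = ?g"
        by (rule entries_vec) (use u in \<open>simp add: entries_def\<close>)
      have "entries (char_matrix C a *\<^sub>v vec n ?g) = entries u"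
        unfolding entries_char_matrix[OF vec_carrier] e True by (rule cox_fixed_in_range[OF u(2)])
      then have "char_matrix C a *\<^sub>v vec n ?g = u"
        using entries_eq_iff[of _ n u] u char_matrix_C[of a] by simp
      then show "\<exists>v \<in> carrier_vec n. char_matrix C a *\<^sub>v v = u" by (intro bexI[of _ "vec n ?g"]) auto
    qed
    ultimately show ?thesis using b True \<open>s \<noteq> 0\<close> by (cases "s = 1") auto
  next
    case False
    have "s \<le> 1"
    proof (rule jordan_nf_block_size_le[OF carrier_w(3) J b])
      show "mat_kernel (char_matrix C a ^\<^sub>m Suc 1) = mat_kernel (char_matrix C a ^\<^sub>m 1)"
        unfolding set_eq_iff mem_kernel_char_matrix_power
        using cox_minus_kernel_square[OF inside_entries False] by auto
    qed
    then show ?thesis using False \<open>s \<noteq> 0\<close> by simp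
  qed
qed

lemma num_blocks_2:
  assumes J: "jordan_nf C J"
  shows "num_blocks 2 J = kernel_dim B"
proof -
  have "fst b = 2 \<longleftrightarrow> snd b = 1" if "b \<in> set J" for b
    using block_sizes[OF J, of "fst b" "snd b"] that by (simp split: if_splits)
  then have "filter (\<lambda>b. fst b = 2) J = filter (\<lambda>b. snd b = 1) J"
    by (intro filter_cong) auto
  then show ?thesis
    unfolding num_blocks_def kernel_dim_B[symmetric] by (simp add: jordan_nf_count_blocks[OF carrier_w(3) J])
qed

lemma diagonal_iff:
  assumes J: "jordan_nf C J"
  shows "diagonal_mat (jordan_matrix J) \<longleftrightarrow> nondegenerate_form n B"
proof -
  have "diagonal_mat (jordan_matrix J) \<longleftrightarrow> 1 \<notin> snd ` set J"
    unfolding diagonal_jordan_matrix_iff using block_sizes[OF J] by force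
  also have "\<dots> \<longleftrightarrow> \<not> eigenvalue C 1" by (simp only: jordan_nf_eigenvalue_iff[OF carrier_w(3) J])
  also have "\<dots> \<longleftrightarrow> nondegenerate_form n B"
    unfolding real_kernel_iff[symmetric] nondegenerate_form_iff by blast
  finally show ?thesis .
qed

lemma kernel_dim_char_matrix_1:
  assumes u: "inside u" "u \<noteq> (\<lambda>i. 0)" "cox_minus a u = (\<lambda>i. 0)"
    and line: "\<And>f. inside f \<Longrightarrow> cox_minus a f = (\<lambda>i. 0) \<Longrightarrow> \<exists>c. f = (\<lambda>i. c * u i)"
  shows "kernel_dim (char_matrix C a) = 1"
proof (rule kernel_dim_eq_1[OF char_matrix_C])
  have e: "entries (vec n u) = u" by (rule entries_vec) (use u in \<open>simp add: inside_def\<close>)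
  show "vec n u \<in> mat_kernel (char_matrix C a)" using u by (simp add: mem_kernel_char_matrix e)
  show "vec n u \<noteq> 0\<^sub>v n" using e u(2) entries_zero[of n] by metis
  fix v assume "v \<in> mat_kernel (char_matrix C a)"
  then have v: "v \<in> carrier_vec n" "cox_minus a (entries v) = (\<lambda>i. 0)" by (auto simp: mem_kernel_char_matrix)
  from line[OF inside_entries[OF v(1)] v(2)] obtain c where "entries v = (\<lambda>i. c * u i)" by blast
  then have "entries v = entries (c \<cdot>\<^sub>v vec n u)" by (simp add: entries_smult e)
  then have "v = c \<cdot>\<^sub>v vec n u" using entries_eq_iff[of v n "c \<cdot>\<^sub>v vec n u"] v by simp
  then show "\<exists>c. v = c \<cdot>\<^sub>v vec n u" by blast
qed

lemma semidefinite_case: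
  assumes nonneg: "nonnegative_form n B" and "\<not> positive_form n B"
  shows "kernel_dim B = 1" and "eigenvalue C a \<Longrightarrow> cmod a = 1"
proof -
  have psd: "psd 1" using nonneg nonnegative_form_iff by simp
  from assms(2) obtain x where x: "x \<in> carrier_vec n" "x \<noteq> 0\<^sub>v n" "tits_form B x \<le> 0"
    unfolding positive_form_def by (auto simp: not_less)
  define g where "g = entries x"
  have "(\<Sum>i<n. w i * (g i * (1 * g i + act n N g i))) \<le> 0"
    using x tits_form_entries[OF x(1)] by (simp add: g_def)
  note null = psd_null_vector[OF psd this]
  have "act n N g i = - g i" for i
  proof (cases "i < n")
    case True
    then show ?thesis using null[OF True] by simp
  qed (use x(1) in \<open>simp add: g_def entries_def\<close>)
  then have Ag: "A (\<lambda>i. of_real (g i)) = (\<lambda>i. - of_real (g i))" by (simp add: act_of_real)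
  have "inside (\<lambda>i. complex_of_real (g i))" using x(1) by (auto simp: g_def inside_def entries_def)
  moreover have "(\<lambda>i. complex_of_real (g i)) \<noteq> (\<lambda>i. 0)"
    using x(2) entries_eq_iff[OF x(1) zero_carrier_vec] by (auto simp: g_def fun_eq_iff)
  ultimately have g: "inside (\<lambda>i. of_real (g i))" "(\<lambda>i. complex_of_real (g i)) \<noteq> (\<lambda>i. 0)" .
  show "kernel_dim B = 1" unfolding kernel_dim_B[symmetric]
  proof (rule kernel_dim_char_matrix_1[OF g])
    show "cox_minus 1 (\<lambda>i. of_real (g i)) = (\<lambda>i. 0)" unfolding cox_fixed_iff by (rule Ag)
    fix f assume f: "inside f" "cox_minus 1 f = (\<lambda>i. 0)"
    show "\<exists>c. f = (\<lambda>i. c * of_real (g i))"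
      by (rule perron_line[OF psd g _ f(1)]) (use Ag f(2) cox_fixed_iff in auto)
  qed
  assume "eigenvalue C a"
  then obtain f where f: "inside f" "f \<noteq> (\<lambda>i. 0)" "cox f = (\<lambda>i. a * f i)"
    unfolding eigenvalue_C_iff by blast
  from cox_eigenvector(2)[OF f] obtain \<mu> where \<mu>: "0 \<le> \<mu>" "(a + 1)\<^sup>2 = 4 * of_real \<mu> * a"
    and Q: "A (A f) = (\<lambda>i. of_real \<mu> * f i)" by blast
  have "sqrt \<mu> \<le> 1" by (rule square_eigenvalue_bound[OF psd f(1,2) Q \<mu>(1)])
  then show "cmod a = 1" using root_unit_circle[OF \<mu>(2,1)] by simp
qed

text \<open>
  On vectors supported in the first class, \<open>N\<^sup>2\<close> is the block \<open>D F\<close>.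
\<close>

lemma act_entries_DF:
  assumes x: "x \<in> carrier_vec m"
  shows "act n N (act n N (entries x)) = entries (D * F *\<^sub>v x)"
proof -
  define y where "y = F *\<^sub>v x"
  have y: "y \<in> carrier_vec k" using F x by (simp add: y_def)
  have 1: "act n N (entries x) = (\<lambda>i. if m \<le> i \<and> i < n then y $ (i - m) else 0)"
  proof
    fix i
    have "act n N (entries x) i = (\<Sum>j<m. N i j * x $ j)"
      using x by (simp add: act_def n_def sum_lessThan_add entries_def)
    also have "\<dots> = (if m \<le> i \<and> i < n then y $ (i - m) else 0)"
    proof (cases "i < n")
      case True
      then show ?thesis
        using F x by (auto simp: N_block n_def y_def scalar_prod_def atLeast0LessThan intro!: sum.cong sum.neutral)
    qed (simp add: N_outside)
    finally show "act n N (entries x) i = (if m \<le> i \<and> i < n then y $ (i - m) else 0)" .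
  qed
  have 2: "act n N (\<lambda>i. if m \<le> i \<and> i < n then y $ (i - m) else 0) = entries (D *\<^sub>v y)"
  proof
    fix i
    have "act n N (\<lambda>i. if m \<le> i \<and> i < n then y $ (i - m) else 0) i = (\<Sum>j<k. N i (m + j) * y $ j)"
      by (simp add: act_def n_def sum_lessThan_add)
    also have "\<dots> = entries (D *\<^sub>v y) i"
    proof (cases "i < n")
      case True
      then show ?thesis
        using D y by (auto simp: N_block n_def entries_def scalar_prod_def atLeast0LessThan intro!: sum.cong sum.neutral)
    qed (use D in \<open>simp add: N_outside n_def entries_def\<close>)
    finally show "act n N (\<lambda>i. if m \<le> i \<and> i < n then y $ (i - m) else 0) i = entries (D *\<^sub>v y) i" .
  qed
  have "D *\<^sub>v y = D * F *\<^sub>v x" unfolding y_def using D F x by (simp add: assoc_mult_mat_vec)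
  with 1 2 show ?thesis by simp
qed

lemma psd_mono:
  assumes "psd s" "s \<le> c" shows "psd c"
  unfolding psd_def
proof
  fix g :: "nat \<Rightarrow> real"
  have "0 \<le> (\<Sum>i<n. w i * (g i * (s * g i + act n N g i)))" using assms(1) by (simp add: psd_def)
  also have "\<dots> \<le> (\<Sum>i<n. w i * (g i * (c * g i + act n N g i)))"
  proof (rule sum_mono)
    fix i assume "i \<in> {..<n}"
    have "(s - c) * (g i * g i) \<le> 0" using assms(2) by (intro mult_nonpos_nonneg) auto
    then have "g i * (s * g i + act n N g i) \<le> g i * (c * g i + act n N g i)"
      by (simp add: algebra_simps)
    then show "w i * (g i * (s * g i + act n N g i)) \<le> w i * (g i * (c * g i + act n N g i))"
      by (rule mult_left_mono) (use \<open>i \<in> {..<n}\<close> in \<open>simp add: w_nonneg\<close>)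
  qed
  finally show "0 \<le> (\<Sum>i<n. w i * (g i * (c * g i + act n N g i)))" .
qed

text \<open>
  Eigenvalues of \<open>D F\<close> are eigenvalues of \<open>N\<^sup>2\<close>, hence at most \<open>s\<^sup>2\<close>; and \<open>s\<^sup>2\<close> occurs, with the
  restriction \<open>(1 + Z) u / 2\<close> of the Perron vector \<open>u\<close> to the first class as eigenvector.
\<close>

lemma phi1_eq:
  assumes psd: "psd s" and s: "1 < s"
    and u: "u \<noteq> (\<lambda>i. 0)" "act n N u = (\<lambda>i. - s * (u i :: real))"
  shows "phi1 D F = s\<^sup>2"
  unfolding phi1_def
proof (rule Max_eqI)
  have DF: "D * F \<in> carrier_mat m m" using D F by simp
  have ev: "eigenvalue (D * F) \<phi> \<longleftrightarrow>
      (\<exists>x \<in> carrier_vec m. x \<noteq> 0\<^sub>v m \<and> act n N (act n N (entries x)) = (\<lambda>i. \<phi> * entries x i))" for \<phi>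
  proof -
    have "D * F *\<^sub>v x = \<phi> \<cdot>\<^sub>v x \<longleftrightarrow> act n N (act n N (entries x)) = (\<lambda>i. \<phi> * entries x i)"
      if "x \<in> carrier_vec m" for x
      using entries_eq_iff[of "D * F *\<^sub>v x" m "\<phi> \<cdot>\<^sub>v x"] that DF D
      by (simp add: act_entries_DF entries_smult)
    then show ?thesis using D unfolding eigenvalue_def eigenvector_def by auto
  qed
  have "char_poly (D * F) \<noteq> 0" using degree_monic_char_poly[OF DF] by auto
  then show "finite {\<phi>. eigenvalue (D * F) \<phi>}"
    using poly_roots_finite eigenvalue_root_char_poly[OF DF] by simp
  show "y \<le> s\<^sup>2" if "y \<in> {\<phi>. eigenvalue (D * F) \<phi>}" for y
  proof -
    from that ev obtain x where x: "x \<in> carrier_vec m" "x \<noteq> 0\<^sub>v m"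
      "act n N (act n N (entries x)) = (\<lambda>i. y * entries x i)" by auto
    let ?f = "\<lambda>i. complex_of_real (entries x i)"
    have "inside ?f" using x(1) by (auto simp: inside_def entries_def) (simp add: n_def)
    moreover have "?f \<noteq> (\<lambda>i. 0)"
      using x(2) entries_eq_iff[OF x(1) zero_carrier_vec] by (auto simp: fun_eq_iff)
    ultimately have f: "inside ?f" "?f \<noteq> (\<lambda>i. 0)" .
    have Q: "A (A ?f) = (\<lambda>i. of_real y * ?f i)" by (simp add: act_of_real x(3))
    from square_eigenvalue_nonneg[OF f Q] have "0 \<le> y" by auto
    with square_eigenvalue_bound[OF psd f Q] have "sqrt y \<le> s" by simp
    then show "y \<le> s\<^sup>2" by (rule sqrt_le_D)
  qed
  let ?x = "vec m u"
  have e: "entries ?x = (\<lambda>i. (1 / 2 + 1 / 2 * of_real (z i)) * u i)"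
    by (auto simp: entries_def z_def fun_eq_iff)
  have Ae: "act n N (entries ?x) = (\<lambda>i. (1 / 2 - 1 / 2 * of_real (z i)) * (- s * u i))"
    unfolding e by (rule ext) (simp only: act_sign u(2))
  have "act n N (act n N (entries ?x)) = (\<lambda>i. s\<^sup>2 * entries ?x i)"
  proof
    fix i
    have "act n N (act n N (entries ?x)) i
      = act n N (\<lambda>i. (1 / 2 + (- 1 / 2) * of_real (z i)) * (- s * u i)) i"
      unfolding Ae by simp
    also have "\<dots> = (1 / 2 - (- 1 / 2) * of_real (z i)) * (- s * (- s * u i))"
      by (simp only: act_sign act_scale u(2))
    also have "\<dots> = s\<^sup>2 * entries ?x i" by (simp add: e power2_eq_square)
    finally show "act n N (act n N (entries ?x)) i = s\<^sup>2 * entries ?x i" .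
  qed
  moreover have "?x \<noteq> 0\<^sub>v m"
  proof
    assume "?x = 0\<^sub>v m"
    then have e0: "entries ?x = (\<lambda>i. 0)" by simp
    have upper: "(1 / 2 - 1 / 2 * z i) * (- s * u i) = 0" for i
      using fun_cong[OF Ae, of i] by (simp add: e0)
    have lower: "(1 / 2 + 1 / 2 * z i) * u i = 0" for i
      using fun_cong[OF e, of i] by (simp add: e0)
    have "u i = 0" for i
      using sign[of i] upper[of i] lower[of i] s by (elim disjE) simp_all
    then show False using u(1) by auto
  qed
  ultimately show "s\<^sup>2 \<in> {\<phi>. eigenvalue (D * F) \<phi>}" using ev by auto
qed

text \<open>
  Indefiniteness forces \<open>s > 1\<close> for the least eigenvalue \<open>- s\<close> of \<open>N\<close>.  Hence \<open>\<lambda>\<^sub>1\<close> and \<open>\<lambda>\<^sub>2\<close> are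
  different from \<open>1\<close> and have blocks of size \<open>1\<close> only, and \<open>cox_line\<close> leaves room for one block each.
\<close>

lemma indefinite_case:
  assumes indef: "indefinite_form n B" and J: "jordan_nf C J"
  shows "1 < phi1 D F"
    and "maximal_eigenvalue C (lambda1 (phi1 D F))" "simple_eigenvalue C (lambda1 (phi1 D F))"
    and "minimal_eigenvalue C (lambda2 (phi1 D F))" "simple_eigenvalue C (lambda2 (phi1 D F))"
proof -
  obtain s and u :: "nat \<Rightarrow> real" where psd: "psd s" and u: "\<forall>i\<ge>n. u i = 0" "u \<noteq> (\<lambda>i. 0)"
    "act n N u = (\<lambda>i. - s * u i)" using lowest_eigenvalue[OF n_pos] by blast
  have "\<not> psd 1"
    using indef unfolding indefinite_form_def nonnegative_form_iff[symmetric] nonnegative_form_def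
    by (auto simp: not_le)
  then have s: "1 < s" using psd_mono[OF psd, of 1] by force
  have phi: "phi1 D F = s\<^sup>2" by (rule phi1_eq[OF psd s u(2,3)])
  show phi_gt: "1 < phi1 D F" unfolding phi using s by (simp add: one_less_power)
  let ?\<phi> = "phi1 D F" and ?u = "\<lambda>i. complex_of_real (u i)"
  have uc: "inside ?u" "?u \<noteq> (\<lambda>i. 0)" "A ?u = (\<lambda>i. - of_real s * ?u i)"
    using u by (auto simp: inside_def act_of_real fun_eq_iff)
  have simple: "simple_eigenvalue C (of_real a)" if "(a + 1)\<^sup>2 = 4 * ?\<phi> * a" "a \<noteq> 0" "a \<noteq> 1" for a
  proof -
    have "complex_of_real ((a + 1)\<^sup>2) = of_real (4 * ?\<phi> * a)" using that(1) by (simp only:)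
    then have "(complex_of_real a + 1)\<^sup>2 = 4 * of_real (s\<^sup>2) * of_real a" by (simp add: phi)
    moreover have "complex_of_real a \<noteq> 0" using that by simp
    ultimately obtain v where v: "inside v" "v \<noteq> (\<lambda>i. 0)" "cox v = (\<lambda>i. of_real a * v i)"
      and line: "\<forall>f. inside f \<and> cox f = (\<lambda>i. of_real a * f i) \<longrightarrow> (\<exists>c. f = (\<lambda>i. c * v i))"
      using cox_line[OF psd s uc, of "of_real a"] by blast
    have cox_minus: "cox_minus (of_real a) f = (\<lambda>i. 0) \<longleftrightarrow> cox f = (\<lambda>i. of_real a * f i)" for f
      by (simp add: cox_minus_def fun_eq_iff)
    have "kernel_dim (char_matrix C (of_real a)) = 1"
      by (rule kernel_dim_char_matrix_1[OF v(1,2)]) (use v(3) line cox_minus in auto)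
    moreover have "r = 1" if "(r, of_real a) \<in> set J" for r
      using block_sizes[OF J that] \<open>a \<noteq> 1\<close> by simp
    ultimately have "Polynomial.order (of_real a) (char_poly C) = 1"
      using jordan_nf_order_unit_blocks[OF carrier_w(3) J] by simp
    moreover have "eigenvalue C (of_real a)" using v unfolding eigenvalue_C_iff by blast
    ultimately show ?thesis by (simp add: simple_eigenvalue_def)
  qed
  note bounds = lambda_bounds[OF phi_gt] and root = lambda_root[OF less_imp_le[OF phi_gt]]
  show simple1: "simple_eigenvalue C (lambda1 ?\<phi>)" using simple[OF root(1)] bounds by simp
  show simple2: "simple_eigenvalue C (lambda2 ?\<phi>)" using simple[OF root(2)] bounds by simp
  have ev: "b \<noteq> 0 \<and> (\<exists>\<mu>\<ge>0. \<mu> \<le> ?\<phi> \<and> (b + 1)\<^sup>2 = 4 * of_real \<mu> * b)" if "eigenvalue C b" for b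
  proof -
    from that obtain f where f: "inside f" "f \<noteq> (\<lambda>i. 0)" "cox f = (\<lambda>i. b * f i)"
      unfolding eigenvalue_C_iff by blast
    from cox_eigenvector(2)[OF f] obtain \<mu> where \<mu>: "0 \<le> \<mu>" "(b + 1)\<^sup>2 = 4 * of_real \<mu> * b"
      and Q: "A (A f) = (\<lambda>i. of_real \<mu> * f i)" by blast
    have "sqrt \<mu> \<le> s" by (rule square_eigenvalue_bound[OF psd f(1,2) Q \<mu>(1)])
    then have "\<mu> \<le> ?\<phi>" unfolding phi by (rule sqrt_le_D)
    with \<mu> cox_eigenvector(1)[OF f] show ?thesis by blast
  qed
  show "maximal_eigenvalue C (lambda1 ?\<phi>)" unfolding maximal_eigenvalue_def
  proof (intro conjI allI impI)
    show "eigenvalue C (lambda1 ?\<phi>)" using simple1 by (simp add: simple_eigenvalue_def)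
    fix b assume b: "eigenvalue C b \<and> b \<noteq> of_real (lambda1 ?\<phi>)"
    with ev obtain \<mu> where \<mu>: "0 \<le> \<mu>" "\<mu> \<le> ?\<phi>" "(b + 1)\<^sup>2 = 4 * of_real \<mu> * b" by blast
    have "cmod b < lambda1 ?\<phi>" using root_less_lambda1[OF \<mu>(3,1,2) phi_gt] b by simp
    then show "cmod b < cmod (of_real (lambda1 ?\<phi>))" using bounds by simp
  qed
  show "minimal_eigenvalue C (lambda2 ?\<phi>)" unfolding minimal_eigenvalue_def
  proof (intro conjI allI impI)
    show "eigenvalue C (lambda2 ?\<phi>)" using simple2 by (simp add: simple_eigenvalue_def)
    fix b assume b: "eigenvalue C b \<and> b \<noteq> of_real (lambda2 ?\<phi>)"
    with ev obtain \<mu> where \<mu>: "b \<noteq> 0" "0 \<le> \<mu>" "\<mu> \<le> ?\<phi>" "(b + 1)\<^sup>2 = 4 * of_real \<mu> * b" by blast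
    have "lambda2 ?\<phi> < cmod b" using lambda2_less_root[OF \<mu>(4,1-3) phi_gt] b by simp
    then show "cmod (of_real (lambda2 ?\<phi>)) < cmod b" using bounds(2) by simp
  qed
qed

end

theorem theorem3p14:
  fixes K :: "int mat" and D F T B :: "real mat" and m k :: nat
    and J :: "(nat \<times> complex) list"
  assumes cartan: "generalized_cartan_matrix (m + k) K"
    and tree: "valued_tree K"
    and D: "D \<in> carrier_mat m k" and F: "F \<in> carrier_mat k m"
    and block_form: "map_mat real_of_int K =
      four_block_mat (2 \<cdot>\<^sub>m 1\<^sub>m m) (2 \<cdot>\<^sub>m D) (2 \<cdot>\<^sub>m F) (2 \<cdot>\<^sub>m 1\<^sub>m k)"
    and tits: "symmetrization (m + k) K T B"
    and jordan: "jordan_nf (coxeter D F) J"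
  shows "(diagonal_mat (jordan_matrix J) \<longleftrightarrow> nondegenerate_form (m + k) B) \<and>
    (nonnegative_form (m + k) B \<and> \<not> positive_form (m + k) B \<longrightarrow>
      num_blocks 2 J = 1 \<and> (\<forall>b \<in> set J. fst b = 1 \<or> fst b = 2) \<and>
      (\<forall>x. eigenvalue (coxeter D F) x \<longrightarrow> cmod x = 1)) \<and>
    (indefinite_form (m + k) B \<and> \<not> nondegenerate_form (m + k) B \<longrightarrow>
      num_blocks 2 J = kernel_dim B \<and> (\<forall>b \<in> set J. fst b = 1 \<or> fst b = 2) \<and>
      maximal_eigenvalue (coxeter D F) (lambda1 (phi1 D F)) \<and>
      simple_eigenvalue (coxeter D F) (lambda1 (phi1 D F)) \<and>
      minimal_eigenvalue (coxeter D F) (lambda2 (phi1 D F)) \<and>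
      simple_eigenvalue (coxeter D F) (lambda2 (phi1 D F)) \<and>
      1 < lambda1 (phi1 D F) \<and> lambda2 (phi1 D F) < 1)"
proof -
  interpret valued_tree_blocks K D F T B m k
    by unfold_locales (fact cartan tree D F block_form tits)+
  have sizes: "\<forall>b \<in> set J. fst b = 1 \<or> fst b = 2"
    using block_sizes[OF jordan] by (metis prod.collapse)
  show ?thesis unfolding n_def[symmetric]
  proof (intro conjI impI)
    show "diagonal_mat (jordan_matrix J) \<longleftrightarrow> nondegenerate_form n B" by (rule diagonal_iff[OF jordan])
  next
    assume "nonnegative_form n B \<and> \<not> positive_form n B"
    then show "num_blocks 2 J = 1" "\<forall>x. eigenvalue C x \<longrightarrow> cmod x = 1"
      using semidefinite_case num_blocks_2[OF jordan] by auto
  next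
    assume "indefinite_form n B \<and> \<not> nondegenerate_form n B"
    then have indef: "indefinite_form n B" by simp
    show "num_blocks 2 J = kernel_dim B" by (rule num_blocks_2[OF jordan])
    note bounds = lambda_bounds[OF indefinite_case(1)[OF indef jordan]]
    show "1 < lambda1 (phi1 D F)" "lambda2 (phi1 D F) < 1" by (rule bounds)+
  qed (use indefinite_case(2-5)[OF _ jordan] sizes in auto)
qed

end
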